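(* Let $x_1,\dots,x_n,a,b,c,d,e$ be indeterminates and $N$ a nonnegative integer such that $a^2q^{N-n+2}=bcde$. Then \begin{multline*} \sum_{k_1,\dots,k_n=0}^N \prod_{1\leq i<j\leq n}\biggl(\frac{E(q^{k_i-k_j}x_i/x_j)}{E(x_i/x_j)} \frac{E(ax_ix_jq^{k_i+k_j})}{E(ax_ix_jq^N)}\biggr) \\ \times\prod_{i=1}^n \frac{E(ax_i^2q^{2k_i})}{E(ax_i^2)} \frac{(ax_i^2,bx_i,cx_i,dx_i,ex_i,q^{-N};q,p)_{k_i}\,q^{ik_i}} {(q,aqx_i/b,aqx_i/c,aqx_i/d,aqx_i/e,ax_i^2q^{N+1};q,p)_{k_i}}\\ =\prod_{i=1}^n\frac{(aqx_i^2,aq^{2-i}/bc,aq^{2-i}/bd,aq^{2-i}/cd;q,p)_N} {(aq^{2-n}/bcdx_i,aqx_i/b,aqx_i/c,aqx_i/d;q,p)_N}. \end{multline*}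
   Context: Let $p$ be a complex number with $|p|<1$, $q$ a nonzero complex number, and all parameters generic so that no denominator vanishes. For nonzero $x$, $E(x)=E(x;p)=\prod_{k\ge 0}(1-xp^k)(1-p^{k+1}/x)$. For integer $m$, $(a;q,p)_m=\prod_{k=0}^{m-1}E(aq^k)$ if $m>0$, $=1$ if $m=0$, and $=1/\prod_{k=0}^{-m-1}E(aq^{m+k})$ if $m<0$; $(a_1,\dots,a_s;q,p)_m=\prod_{i=1}^s(a_i;q,p)_m$. *)

theory Defs
  imports "HOL-Analysis.Analysis"
begin

definition ellE :: "complex \<Rightarrow> complex \<Rightarrow> complex" where
  "ellE x p = (\<Prod>k. (1 - x * p ^ k) * (1 - p ^ (k + 1) / x))"

definition ellpoch :: "complex \<Rightarrow> complex \<Rightarrow> complex \<Rightarrow> int \<Rightarrow> complex" where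
  "ellpoch a q p m =
     (if m > 0 then (\<Prod>k<nat m. ellE (a * q ^ k) p)
      else if m = 0 then 1
      else 1 / (\<Prod>k<nat (- m). ellE (a * q powi (m + int k)) p))"

end

theory Submission
  imports Defs "Jordan_Normal_Form.Determinant"
begin

text \<open>
  The products over pairs \<open>i < j\<close> form, up to explicit factors, the determinant of the matrix with entries
  \<open>\<Prod>r<n-1-j. E (b q\<^sup>r X\<^sub>i) E (a X\<^sub>i / b q\<^sup>r) \<cdot> \<Prod>s<j. E (c q\<^sup>s X\<^sub>i) E (a X\<^sub>i / c q\<^sup>s)\<close>,
  \<open>X\<^sub>i = x\<^sub>i q^k\<^sub>i\<close>. By multilinearity in the rows the multiple sum becomes a determinant of single sums;
  each of them is the Frenkel--Turaev sum with \<open>b\<close>, \<open>c\<close> replaced by \<open>b q^(n-1-j)\<close>, \<open>c q^j\<close>, and its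
  value is, up to row and column factors, the same matrix entry with \<open>a\<close> replaced by \<open>a q^N\<close> and \<open>k\<^sub>i = 0\<close>.
  Both the determinant evaluation and the Frenkel--Turaev sum (by induction on \<open>N\<close>) come from the
  addition formula of the theta function, which is read off from the Jacobi triple product.
  The argument divides by factors not assumed to be nonzero in the theorem; it is
  therefore carried out for generic parameters and transferred by continuity.
\<close>

section \<open>The Jacobi triple product\<close>

text \<open>The entries are chosen so that a row factor does nothing but shift parameters:
  \<open>P (b x) k * P (b x q^k) m = P (b x) m * P (b q^m x) k\<close>, and the reflected factors do
  the same in the denominators. Since \<open>m + j = n - 1\<close> in column j, all entries need the
  same e; this is where the n in the balancing condition comes from. In the value of the sum for row
  i and column j, the factors containing both b and c depend on \<open>m + j\<close> only, so what
  remains splits into a row factor and a column factor. The weight \<open>q^(i k_i)\<close> is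
  forced as well: one \<open>q^(k_i)\<close> belongs to the Frenkel--Turaev summand, and the
  remaining power is the monomial in X_i left over by the determinant evaluation. The constant of
  the determinant vanishes for some admissible parameters, for example when b = c and n > 1, so it
  cannot be cancelled directly.\<close>

definition qfact :: "complex \<Rightarrow> nat \<Rightarrow> complex" where
  "qfact p m = (\<Prod>k<m. 1 - p ^ Suc k)"

text \<open>With the value \<open>0\<close> at negative arguments the recursion \<open>qfact_inv_diff_one\<close> has no boundary cases,
  and the finite expansions below are sums over all integers.\<close>
definition qfact_inv :: "complex \<Rightarrow> int \<Rightarrow> complex" where
  "qfact_inv p m = (if m < 0 then 0 else 1 / qfact p (nat m))"

lemma one_minus_power_nz:
  fixes p :: complex
  assumes "norm p < 1"
  shows "1 - p ^ Suc k \<noteq> 0"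
proof
  assume "1 - p ^ Suc k = 0"
  then have "norm (p ^ Suc k) = 1"
    by (metis eq_iff_diff_eq_0 norm_one)
  then have "norm p ^ Suc k = 1"
    by (simp add: norm_power norm_mult)
  then show False
    using assms power_Suc_less_one[of "norm p" k] by (cases "p = 0") (auto simp del: power_Suc)
qed

lemma qfact_nz: "norm p < 1 \<Longrightarrow> qfact p m \<noteq> 0"
  using one_minus_power_nz unfolding qfact_def by (simp del: power_Suc)

lemma qfact_inv_diff_one:
  assumes "norm p < 1" "p \<noteq> 0"
  shows "qfact_inv p (m - 1) = (1 - p powi m) * qfact_inv p m"
proof -
  consider "m < 0" | "m = 0" | "m > 0" by linarith
  then show ?thesis
  proof cases
    case 3
    define k where "k = nat (m - 1)"
    have m: "m = int (Suc k)" using 3 by (simp add: k_def)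
    have "1 - p ^ Suc k \<noteq> 0" "qfact p k \<noteq> 0"
      using one_minus_power_nz qfact_nz assms by blast+
    moreover have "nat (int (Suc k)) = Suc k" by simp
    ultimately show ?thesis
      unfolding m qfact_inv_def power_int_of_nat by (simp add: qfact_def del: power_Suc)
  qed (auto simp: qfact_inv_def)
qed

definition tri :: "int \<Rightarrow> int" where "tri j = j * (j - 1) div 2"

lemma tri_twice: "2 * tri j = j * (j - 1)"
proof -
  have "even (j * (j - 1))" by auto
  then show ?thesis unfolding tri_def by simp
qed

definition theta_coeff :: "complex \<Rightarrow> int \<Rightarrow> complex" where
  "theta_coeff p j = (- 1) powi j * p powi tri j"

lemma theta_coeff_diff_one:
  assumes "p \<noteq> 0"
  shows "theta_coeff p (j - 1) = - theta_coeff p j * p powi (1 - j)"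
proof -
  have "tri (j - 1) = tri j + (1 - j)"
    using tri_twice[of j] tri_twice[of "j - 1"] by (simp add: algebra_simps)
  then show ?thesis
    using assms unfolding theta_coeff_def
    by (simp add: power_int_add power_int_diff)
qed

lemma theta_coeff_add_one:
  assumes "p \<noteq> 0"
  shows "theta_coeff p (j + 1) = - theta_coeff p j * p powi j"
proof -
  have "tri (j + 1) = tri j + j"
    using tri_twice[of j] tri_twice[of "j + 1"] by (simp add: algebra_simps)
  then show ?thesis
    using assms unfolding theta_coeff_def
    by (simp add: power_int_add)
qed

section \<open>Finite form of the triple product\<close>

definition theta_factor :: "complex \<Rightarrow> complex \<Rightarrow> nat \<Rightarrow> complex" where
  "theta_factor p x k = (1 - x * p ^ k) * (1 - p ^ (k + 1) / x)"

text \<open>The p-binomial coefficient of \<open>2 N\<close> over \<open>N + j\<close>, which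
  vanishes for j outside the range from -N to N.\<close>

definition jtp_coeff :: "complex \<Rightarrow> nat \<Rightarrow> int \<Rightarrow> complex" where
  "jtp_coeff p N j = qfact p (2 * N) * qfact_inv p (int N - j) * qfact_inv p (int N + j)"

lemma has_sum_shift:
  fixes f :: "int \<Rightarrow> complex"
  shows "((\<lambda>j. f (j + k)) has_sum s) UNIV \<longleftrightarrow> (f has_sum s) UNIV"
  by (rule has_sum_reindex_bij_betw)
     (rule bij_betw_byWitness[where f' = "\<lambda>j. j - k"], auto)

text \<open>This compares coefficients of x^j after multiplication by
  \<open>(1 - x p^N) (1 - p^(N+1) / x)\<close>, the factor of index N in the product. In terms of A
  = p^(N+1-j) and B = p^(N+1+j) it becomes a polynomial identity.\<close>

lemma jtp_coeff_Suc:
  assumes "norm p < 1" "p \<noteq> 0"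
  shows "theta_coeff p j * jtp_coeff p (Suc N) j =
    (1 + p ^ (2 * N + 1)) * (theta_coeff p j * jtp_coeff p N j)
    - p ^ N * (theta_coeff p (j - 1) * jtp_coeff p N (j - 1))
    - p ^ (N + 1) * (theta_coeff p (j + 1) * jtp_coeff p N (j + 1))"
proof -
  define A B where "A = p powi (int N + 1 - j)" and "B = p powi (int N + 1 + j)"
  define u v where "u = qfact_inv p (int N + 1 - j)" and "v = qfact_inv p (int N + 1 + j)"
  note R = qfact_inv_diff_one[OF assms]
  have 1: "qfact_inv p (int N - j) = (1 - A) * u"
    using R[of "int N + 1 - j"] by (simp add: A_def u_def)
  have 2: "qfact_inv p (int N + j) = (1 - B) * v"
    using R[of "int N + 1 + j"] by (simp add: B_def v_def)
  have p1: "p powi (int N - j) = A / p" "p powi (int N + j) = B / p"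
    unfolding A_def B_def using assms(2)
    by (simp_all add: power_int_add power_int_diff)
  have 3: "qfact_inv p (int N - (j + 1)) = (1 - A / p) * ((1 - A) * u)"
    using R[of "int N - j"] unfolding 1 p1 by (simp add: diff_diff_eq)
  have 4: "qfact_inv p (int N + (j - 1)) = (1 - B / p) * ((1 - B) * v)"
    using R[of "int N + j"] unfolding 2 p1 by (simp add: add_diff_eq)
  have 5: "qfact_inv p (int N - (j - 1)) = u" "qfact_inv p (int N + (j + 1)) = v"
    by (simp_all add: u_def v_def algebra_simps)
  have AB: "p ^ (2 * N + 1) = A * B / p" "p ^ (2 * N + 2) = A * B"
  proof -
    have "A * B = p powi int (2 * N + 2)"
      unfolding A_def B_def using assms(2) by (simp flip: power_int_add add: add.commute)
    then show "p ^ (2 * N + 2) = A * B" unfolding power_int_of_nat by simp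
    then show "p ^ (2 * N + 1) = A * B / p" using assms(2) by (simp add: field_simps)
  qed
  have q2: "qfact p (2 * Suc N) = qfact p (2 * N) * (1 - A * B / p) * (1 - A * B)"
    using AB by (simp add: qfact_def)
  have c1: "p ^ N * theta_coeff p (j - 1) = - theta_coeff p j * A"
  proof -
    have "p ^ N * p powi (1 - j) = A"
      unfolding A_def using assms(2)
      by (simp flip: power_int_of_nat power_int_add add: algebra_simps)
    then show ?thesis using theta_coeff_diff_one[OF assms(2), of j] by (simp add: mult_ac)
  qed
  have c2: "p ^ (N + 1) * theta_coeff p (j + 1) = - theta_coeff p j * B"
  proof -
    have "p ^ (N + 1) * p powi j = B"
      unfolding B_def using assms(2)
      by (simp flip: power_int_of_nat power_int_add add: algebra_simps)
    then show ?thesis using theta_coeff_add_one[OF assms(2), of j] by (simp add: mult_ac)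
  qed
  have t: "int (Suc N) - j = int N + 1 - j" "int (Suc N) + j = int N + 1 + j" by simp_all
  have "theta_coeff p j * jtp_coeff p (Suc N) j
    = theta_coeff p j * (qfact p (2 * N) * (1 - A * B / p) * (1 - A * B)) * u * v"
    unfolding jtp_coeff_def t q2 u_def v_def by (simp add: mult_ac)
  also have "\<dots> = (1 + A * B / p) * (theta_coeff p j * (qfact p (2 * N) * ((1 - A) * u) * ((1 - B) * v)))
    + (theta_coeff p j * A) * (qfact p (2 * N) * u * ((1 - B / p) * ((1 - B) * v)))
    + (theta_coeff p j * B) * (qfact p (2 * N) * ((1 - A / p) * ((1 - A) * u)) * v)"
  proof -
    \<comment> \<open>The quotient \<open>1 / p\<close> is replaced by a free variable r, which
      leaves a polynomial identity in A, B and r.\<close>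
    have "theta_coeff p j * (qfact p (2 * N) * (1 - A * B * r) * (1 - A * B)) * u * v
      = (1 + A * B * r) * (theta_coeff p j * (qfact p (2 * N) * ((1 - A) * u) * ((1 - B) * v)))
      + (theta_coeff p j * A) * (qfact p (2 * N) * u * ((1 - B * r) * ((1 - B) * v)))
      + (theta_coeff p j * B) * (qfact p (2 * N) * ((1 - A * r) * ((1 - A) * u)) * v)" for r
      by (simp add: algebra_simps)
    from this[of "1 / p"] show ?thesis by simp
  qed
  also have "\<dots> = (1 + p ^ (2 * N + 1)) * (theta_coeff p j * jtp_coeff p N j)
    - (p ^ N * theta_coeff p (j - 1)) * jtp_coeff p N (j - 1)
    - (p ^ (N + 1) * theta_coeff p (j + 1)) * jtp_coeff p N (j + 1)"
    unfolding c1 c2 AB jtp_coeff_def 1 2 3 4 5 by simp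
  finally show ?thesis by (simp add: mult_ac)
qed

text \<open>Induction on N: the new factor has the monomials 1, x and 1/x, so the new series is a
  combination of the old one and its two index shifts.\<close>

lemma finite_jacobi_triple_product:
  assumes "norm p < 1" "p \<noteq> 0" "x \<noteq> 0"
  shows "((\<lambda>j. theta_coeff p j * jtp_coeff p N j * x powi j)
           has_sum (\<Prod>k<N. theta_factor p x k)) UNIV"
proof (induction N)
  case 0
  have "((\<lambda>j::int. if j = 0 then 1 else 0 :: complex) has_sum 1) UNIV"
    using has_sum_finite_neutralI[of "{0::int}" UNIV "\<lambda>j. if j = 0 then 1 else 0 :: complex" 1] by auto
  moreover have "theta_coeff p j * jtp_coeff p 0 j * x powi j = (if j = 0 then 1 else 0)" for j
    by (auto simp: jtp_coeff_def qfact_inv_def qfact_def theta_coeff_def tri_def)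
  ultimately show ?case by simp
next
  case (Suc N)
  let ?f = "\<lambda>N j. theta_coeff p j * jtp_coeff p N j * x powi j"
  let ?S = "\<Prod>k<N. theta_factor p x k"
  have a: "((\<lambda>j. (1 + p ^ (2 * N + 1)) * ?f N j) has_sum (1 + p ^ (2 * N + 1)) * ?S) UNIV"
    using Suc by (rule has_sum_cmult_right)
  have b: "((\<lambda>j. (- (p ^ N) * x) * ?f N (j + - 1)) has_sum (- (p ^ N) * x) * ?S) UNIV"
    by (rule has_sum_cmult_right) (use Suc has_sum_shift[of "?f N" "-1"] in simp)
  have c: "((\<lambda>j. (- (p ^ (N + 1)) / x) * ?f N (j + 1)) has_sum (- (p ^ (N + 1)) / x) * ?S) UNIV"
    by (rule has_sum_cmult_right) (use Suc has_sum_shift[of "?f N" "1"] in simp)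
  have "((\<lambda>j. (1 + p ^ (2 * N + 1)) * ?f N j + (- (p ^ N) * x) * ?f N (j + - 1)
      + (- (p ^ (N + 1)) / x) * ?f N (j + 1)) has_sum
     (1 + p ^ (2 * N + 1)) * ?S + (- (p ^ N) * x) * ?S + (- (p ^ (N + 1)) / x) * ?S) UNIV"
    using has_sum_add[OF has_sum_add[OF a b] c] .
  moreover have "(1 + p ^ (2 * N + 1)) * ?S + (- (p ^ N) * x) * ?S + (- (p ^ (N + 1)) / x) * ?S
     = (\<Prod>k<Suc N. theta_factor p x k)"
    using assms(3) by (simp add: theta_factor_def field_simps power_mult power2_eq_square)
  moreover have "(1 + p ^ (2 * N + 1)) * ?f N j + (- (p ^ N) * x) * ?f N (j + - 1)
      + (- (p ^ (N + 1)) / x) * ?f N (j + 1) = ?f (Suc N) j" for j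
  proof -
    have x: "x * x powi (j + - 1) = x powi j" "x powi (j + 1) / x = x powi j"
      using assms(3) by (simp_all add: power_int_add power_int_diff)
    have "(1 + p ^ (2 * N + 1)) * ?f N j + (- (p ^ N) * x) * ?f N (j + - 1)
      + (- (p ^ (N + 1)) / x) * ?f N (j + 1)
      = (1 + p ^ (2 * N + 1)) * ?f N j
       - p ^ N * (theta_coeff p (j - 1) * jtp_coeff p N (j - 1)) * (x * x powi (j + - 1))
       - p ^ (N + 1) * (theta_coeff p (j + 1) * jtp_coeff p N (j + 1)) * (x powi (j + 1) / x)"
      by simp
    also have "\<dots> = ?f (Suc N) j"
      unfolding jtp_coeff_Suc[OF assms(1,2)] x by (simp add: algebra_simps)
    finally show ?thesis .
  qed
  ultimately show ?case by (simp only:)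
qed

section \<open>Passage to the infinite product\<close>

lemma convergent_prod_geometric:
  fixes p z :: complex
  assumes "norm p < 1"
  shows "convergent_prod (\<lambda>k. 1 - z * p ^ k)"
proof (rule abs_convergent_prod_imp_convergent_prod, rule summable_imp_abs_convergent_prod)
  have "summable (\<lambda>k. norm z * norm p ^ k)"
    using assms by (intro summable_mult summable_geometric) simp
  then show "summable (\<lambda>k. norm (1 - z * p ^ k - 1))"
    by (simp add: norm_mult norm_power)
qed

lemma convergent_prod_theta_factor:
  assumes "norm p < 1"
  shows "convergent_prod (theta_factor p x)"
proof -
  have "convergent_prod (\<lambda>k. (1 - x * p ^ k) * (1 - (p / x) * p ^ k))"
    by (intro convergent_prod_mult convergent_prod_geometric assms)
  then show ?thesis unfolding theta_factor_def by simp
qed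

lemma ellE_prodinf: "ellE x p = prodinf (theta_factor p x)"
  unfolding ellE_def theta_factor_def ..

lemma ellE_tendsto:
  assumes "norm p < 1"
  shows "(\<lambda>N. \<Prod>k<N. theta_factor p x k) \<longlonglongrightarrow> ellE x p"
  using convergent_prod_LIMSEQ[OF convergent_prod_theta_factor[OF assms], of x]
  unfolding ellE_prodinf LIMSEQ_lessThan_iff_atMost .

text \<open>A convergent infinite product vanishes only if one of its factors does. The zeros
  thereby become explicit.\<close>

lemma ellE_eq_0_iff:
  assumes "norm p < 1"
  shows "ellE x p = 0 \<longleftrightarrow> (\<exists>k. theta_factor p x k = 0)"
proof -
  have "theta_factor p x has_prod ellE x p"
    unfolding ellE_prodinf using convergent_prod_theta_factor[OF assms] by blast
  moreover have "0 \<in> range (theta_factor p x) \<longleftrightarrow> (\<exists>k. theta_factor p x k = 0)"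
    by (metis rangeE rangeI)
  ultimately show ?thesis
    by (simp only: has_prod_eq_0_iff)
qed

lemma qfact_tendsto:
  assumes "norm p < 1"
  obtains L where "L \<noteq> 0" "qfact p \<longlonglongrightarrow> L"
proof
  have c: "convergent_prod (\<lambda>k. 1 - p ^ Suc k)"
    using convergent_prod_geometric[OF assms, of p] by simp
  show "(\<Prod>k. 1 - p ^ Suc k) \<noteq> 0"
    by (rule prodinf_nonzero[OF c]) (rule one_minus_power_nz[OF assms])
  show "qfact p \<longlonglongrightarrow> (\<Prod>k. 1 - p ^ Suc k)"
    using convergent_prod_LIMSEQ[OF c] unfolding qfact_def LIMSEQ_lessThan_iff_atMost .
qed

lemma filterlim_nat_int_shift: "filterlim (\<lambda>N. nat (int N + j)) sequentially sequentially"
  unfolding filterlim_at_top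
proof
  fix Z :: nat
  show "eventually (\<lambda>N. Z \<le> nat (int N + j)) sequentially"
    by (rule eventually_sequentiallyI[of "Z + nat \<bar>j\<bar>"]) linarith
qed

lemma qfact_inv_tendsto:
  assumes "norm p < 1" "qfact p \<longlonglongrightarrow> L" "L \<noteq> 0"
  shows "(\<lambda>N. qfact_inv p (int N + j)) \<longlonglongrightarrow> 1 / L"
proof -
  have "(\<lambda>N. 1 / qfact p (nat (int N + j))) \<longlonglongrightarrow> 1 / L"
    by (intro tendsto_divide tendsto_const assms(3)
        filterlim_compose[OF assms(2) filterlim_nat_int_shift])
  moreover have "eventually (\<lambda>N. qfact_inv p (int N + j) = 1 / qfact p (nat (int N + j))) sequentially"
    by (rule eventually_sequentiallyI[of "nat \<bar>j\<bar>"]) (auto simp: qfact_inv_def)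
  ultimately show ?thesis
    by (simp add: tendsto_cong)
qed

lemma jtp_coeff_tendsto:
  assumes "norm p < 1" "qfact p \<longlonglongrightarrow> L" "L \<noteq> 0"
  shows "(\<lambda>N. jtp_coeff p N j) \<longlonglongrightarrow> 1 / L"
proof -
  have "filterlim (\<lambda>N. 2 * N) sequentially sequentially"
    by (rule filterlim_subseq) (auto simp: strict_mono_def)
  then have "(\<lambda>N. qfact p (2 * N)) \<longlonglongrightarrow> L"
    by (rule filterlim_compose[OF assms(2)])
  moreover have "(\<lambda>N. qfact_inv p (int N - j)) \<longlonglongrightarrow> 1 / L"
    using qfact_inv_tendsto[OF assms, of "- j"] by simp
  ultimately have "(\<lambda>N. jtp_coeff p N j) \<longlonglongrightarrow> L * (1 / L) * (1 / L)"
    unfolding jtp_coeff_def by (intro tendsto_mult qfact_inv_tendsto[OF assms])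
  then show ?thesis using assms(3) by simp
qed

text \<open>\<open>qfact p\<close> and its reciprocal both converge, hence are bounded. The uniform
  constant supplies the majorant for the passage to the limit.\<close>

lemma jtp_coeff_bounded:
  assumes "norm p < 1"
  obtains C where "\<And>N j. norm (jtp_coeff p N j) \<le> C"
proof -
  obtain L where L: "L \<noteq> 0" "qfact p \<longlonglongrightarrow> L" using qfact_tendsto[OF assms] .
  have "Bseq (qfact p)" using L(2) by (meson convergentI convergent_imp_Bseq)
  then obtain A where A: "\<And>n. norm (qfact p n) \<le> A" "A > 0" unfolding Bseq_def by blast
  have "(\<lambda>n. 1 / qfact p n) \<longlonglongrightarrow> 1 / L" by (intro tendsto_divide tendsto_const L)
  then have "Bseq (\<lambda>n. 1 / qfact p n)" by (meson convergentI convergent_imp_Bseq)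
  then obtain B where B: "\<And>n. norm (1 / qfact p n) \<le> B" "B > 0" unfolding Bseq_def by blast
  have B': "norm (qfact_inv p m) \<le> B" for m
    using B by (auto simp: qfact_inv_def)
  have "norm (jtp_coeff p N j) \<le> A * B * B" for N j
    unfolding jtp_coeff_def norm_mult
    using A B B' by (intro mult_mono) auto
  then show thesis using that by blast
qed

text \<open>The half of the theta series with nonnegative indices, taken as a power series because
  continuity of \<open>ellE\<close> will be read off from it.\<close>

definition partial_theta :: "complex \<Rightarrow> complex \<Rightarrow> complex" where
  "partial_theta p z = (\<Sum>n. p ^ (n * (n - 1) div 2) * z ^ n)"

lemma summable_partial_theta:
  fixes p z :: complex
  assumes "norm p < 1"
  shows "summable (\<lambda>n. norm (p ^ (n * (n - 1) div 2) * z ^ n))"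
proof -
  have "(\<lambda>n. norm p ^ n * norm z) \<longlonglongrightarrow> 0 * norm z"
    by (intro tendsto_mult LIMSEQ_realpow_zero tendsto_const) (use assms in auto)
  then have "eventually (\<lambda>n. norm p ^ n * norm z < 1 / 2) sequentially"
    by (rule order_tendstoD) simp
  then obtain M where M: "\<And>n. n \<ge> M \<Longrightarrow> norm p ^ n * norm z < 1 / 2"
    unfolding eventually_sequentially by blast
  show ?thesis
  proof (rule summable_ratio_test[of "1 / 2" M])
    fix n assume n: "n \<ge> M"
    have "Suc n * (Suc n - 1) div 2 = n * (n - 1) div 2 + n"
    proof -
      have "Suc n * (Suc n - 1) = n * (n - 1) + n * 2" by (cases n) auto
      then show ?thesis by simp
    qed
    then have "norm (p ^ (Suc n * (Suc n - 1) div 2) * z ^ Suc n)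
      = (norm p ^ n * norm z) * norm (p ^ (n * (n - 1) div 2) * z ^ n)"
      by (simp add: norm_mult norm_power power_add)
    also have "\<dots> \<le> 1 / 2 * norm (p ^ (n * (n - 1) div 2) * z ^ n)"
      using M[OF n] by (intro mult_right_mono) auto
    finally show "norm (norm (p ^ (Suc n * (Suc n - 1) div 2) * z ^ Suc n))
      \<le> 1 / 2 * norm (norm (p ^ (n * (n - 1) div 2) * z ^ n))" by simp
  qed simp
qed

lemma isCont_partial_theta:
  assumes "norm p < 1"
  shows "isCont (partial_theta p) z"
  unfolding partial_theta_def
  by (rule isCont_powser_converges_everywhere)
     (rule summable_norm_cancel[OF summable_partial_theta[OF assms]])

lemma theta_term_nonneg:
  assumes "p \<noteq> 0"
  shows "theta_coeff p (int n) * x powi int n = p ^ (n * (n - 1) div 2) * (- x) ^ n"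
proof -
  have "tri (int n) = int (n * (n - 1) div 2)"
    unfolding tri_def by (cases n) (auto simp: zdiv_int algebra_simps)
  then show ?thesis
    by (simp add: theta_coeff_def power_int_of_nat power_minus[of x])
qed

text \<open>For \<open>j = - n - 1\<close> the exponent \<open>tri j\<close> is the triangular
  number belonging to \<open>n + 2\<close>. The negative half is therefore again a partial theta
  series, in -1/x and without its first two terms 1 and -1/x.\<close>

lemma theta_term_neg:
  assumes "p \<noteq> 0" "x \<noteq> 0"
  shows "theta_coeff p (- int n - 1) * x powi (- int n - 1)
    = - x * (p ^ (Suc (Suc n) * (Suc (Suc n) - 1) div 2) * (- 1 / x) ^ Suc (Suc n))"
proof -
  define t where "t = Suc (Suc n) * (Suc (Suc n) - 1) div 2"
  have "tri (- int n - 1) = int t"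
  proof -
    have "(- int n - 1) * (- int n - 1 - 1) = int (Suc (Suc n) * (Suc (Suc n) - 1))"
      by (simp add: algebra_simps)
    then show ?thesis unfolding tri_def t_def zdiv_int by simp
  qed
  moreover have "(- 1) powi (- int n - 1) * x powi (- int n - 1) = (- 1 / x) ^ Suc n"
  proof -
    have "(- 1) powi (- int n - 1) * x powi (- int n - 1) = (- x) powi (- int n - 1)"
      by (metis mult_minus1 power_int_mult_distrib)
    also have J: "- int n - 1 = - int (Suc n)" by simp
    also have "(- x) powi - int (Suc n) = inverse (- x) ^ Suc n"
      by (simp only: power_int_minus power_int_of_nat power_inverse)
    also have "inverse (- x) = - 1 / x" by (simp add: divide_inverse)
    finally show ?thesis unfolding J .
  qed
  moreover have "- x * (- 1 / x) ^ Suc (Suc n) = (- 1 / x) ^ Suc n"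
    using assms by simp
  ultimately have "theta_coeff p (- int n - 1) * x powi (- int n - 1)
    = p ^ t * (- x * (- 1 / x) ^ Suc (Suc n))"
    unfolding theta_coeff_def by (simp only: power_int_of_nat mult_ac)
  then show ?thesis unfolding t_def by (simp only: mult_ac)
qed

lemma theta_series_split:
  assumes "norm p < 1" "p \<noteq> 0" "x \<noteq> 0"
  shows "(\<lambda>j. norm (theta_coeff p j * x powi j)) summable_on UNIV"
    and "(\<Sum>\<^sub>\<infinity>j. theta_coeff p j * x powi j)
      = partial_theta p (- x) - x * (partial_theta p (- 1 / x) - 1 + 1 / x)"
proof -
  let ?f = "\<lambda>j. theta_coeff p j * x powi j"
  let ?g = "\<lambda>z n. p ^ (n * (n - 1) div 2) * z ^ n"
  let ?m = "\<lambda>n. - int n - 1"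
  have s1: "summable (\<lambda>n. norm (?f (int n)))"
    unfolding theta_term_nonneg[OF assms(2)] by (rule summable_partial_theta[OF assms(1)])
  have "summable (\<lambda>n. norm (?g (- 1 / x) (n + 2)))"
    using summable_ignore_initial_segment[OF summable_partial_theta[OF assms(1), of "- 1 / x"], of 2] .
  then have s2: "summable (\<lambda>n. norm (?f (?m n)))"
    unfolding theta_term_neg[OF assms(2,3)] norm_mult[of "- x"]
    by (intro summable_mult) simp
  have inj: "inj_on int UNIV" "inj_on ?m UNIV" by (auto simp: inj_on_def)
  have a1: "(\<lambda>j. norm (?f j)) summable_on range int"
    using s1 by (subst summable_on_reindex) (auto simp: o_def summable_on_UNIV_nonneg_real_iff)
  have a2: "(\<lambda>j. norm (?f j)) summable_on range ?m"
    using s2 by (subst summable_on_reindex[OF inj(2)]) (auto simp: o_def summable_on_UNIV_nonneg_real_iff)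
  have U: "(UNIV :: int set) = range int \<union> range ?m"
  proof -
    have "j \<in> range int \<union> range ?m" for j
    proof (cases "j \<ge> 0")
      case True then show ?thesis by (metis UnI1 nonneg_int_cases rangeI)
    next
      case False
      then have "j = ?m (nat (- j - 1))" by simp
      then show ?thesis by blast
    qed
    then show ?thesis by blast
  qed
  have D: "range int \<inter> range ?m = {}" by auto
  show "(\<lambda>j. norm (?f j)) summable_on UNIV"
    unfolding U by (rule summable_on_Un_disjoint[OF a1 a2 D])
  have "(\<Sum>\<^sub>\<infinity>j. ?f j) = infsum ?f (range int) + infsum ?f (range ?m)"
    unfolding U by (rule infsum_Un_disjoint[OF abs_summable_summable[OF a1] abs_summable_summable[OF a2] D])
  also have "infsum ?f (range int) = partial_theta p (- x)"
  proof -
    have "infsum ?f (range int) = (\<Sum>\<^sub>\<infinity>n. ?f (int n))"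
      by (subst infsum_reindex[OF inj(1)]) (simp add: o_def)
    also have "\<dots> = (\<Sum>n. ?f (int n))"
      using norm_summable_imp_has_sum[OF s1 summable_sums[OF summable_norm_cancel[OF s1]]]
      by (rule infsumI)
    finally show ?thesis unfolding theta_term_nonneg[OF assms(2)] partial_theta_def .
  qed
  also have "infsum ?f (range ?m) = - x * (partial_theta p (- 1 / x) - 1 + 1 / x)"
  proof -
    have "infsum ?f (range ?m) = (\<Sum>\<^sub>\<infinity>n. ?f (?m n))"
      by (subst infsum_reindex[OF inj(2)]) (simp add: o_def)
    also have "\<dots> = (\<Sum>n. ?f (?m n))"
      using norm_summable_imp_has_sum[OF s2 summable_sums[OF summable_norm_cancel[OF s2]]]
      by (rule infsumI)
    also have "\<dots> = (\<Sum>n. - x * ?g (- 1 / x) (n + 2))"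
      unfolding theta_term_neg[OF assms(2,3)] by simp
    also have "\<dots> = - x * (\<Sum>n. ?g (- 1 / x) (n + 2))"
      using summable_norm_cancel[OF summable_partial_theta[OF assms(1), of "- 1 / x"]]
      by (intro suminf_mult summable_ignore_initial_segment)
    also have "(\<Sum>n. ?g (- 1 / x) (n + 2)) = partial_theta p (- 1 / x) - (\<Sum>n<2. ?g (- 1 / x) n)"
      unfolding partial_theta_def
      using summable_norm_cancel[OF summable_partial_theta[OF assms(1), of "- 1 / x"]]
      by (rule suminf_minus_initial_segment)
    finally show ?thesis by (simp add: numeral_2_eq_2)
  qed
  finally show "(\<Sum>\<^sub>\<infinity>j. ?f j) = partial_theta p (- x) - x * (partial_theta p (- 1 / x) - 1 + 1 / x)"
    by simp
qed

text \<open>The limit of the finite identity as N grows: the p-binomial coefficients tend to 1/L,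
  where L is the infinite product of \<open>1 - p^k\<close> over k >= 1. The theta series, scaled by
  the bound for the coefficients, is a summable majorant.\<close>

theorem jacobi_triple_product:
  assumes "norm p < 1" "p \<noteq> 0" "x \<noteq> 0" "qfact p \<longlonglongrightarrow> L" "L \<noteq> 0"
  shows "((\<lambda>j. theta_coeff p j * x powi j) has_sum L * ellE x p) UNIV"
proof -
  let ?f = "\<lambda>j. theta_coeff p j * x powi j"
  \<comment> \<open>Tannery's theorem is applied to series over the natural numbers, so the integers
    are enumerated by \<open>int_decode\<close>; absolute convergence makes the order
    irrelevant.\<close>
  define a where "a k N = theta_coeff p (int_decode k) * jtp_coeff p N (int_decode k) * x powi int_decode k" for k N
  define b where "b k = theta_coeff p (int_decode k) * (1 / L) * x powi int_decode k" for k
  obtain C where C: "\<And>N j. norm (jtp_coeff p N j) \<le> C" using jtp_coeff_bounded[OF assms(1)] by blast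
  have abs: "(\<lambda>j. norm (?f j)) summable_on UNIV" by (rule theta_series_split[OF assms(1-3)])
  then have "(\<lambda>k. norm (?f (int_decode k))) summable_on UNIV"
    using summable_on_reindex_bij_betw[OF bij_int_decode, of "\<lambda>j. norm (?f j)"] by simp
  then have sm: "summable (\<lambda>k. C * norm (?f (int_decode k)))"
    by (intro summable_mult) (simp add: summable_on_UNIV_nonneg_real_iff)
  have "((\<lambda>N. suminf (\<lambda>k. a k N)) \<longlonglongrightarrow> suminf b)"
  proof (rule tannerys_theorem[THEN conjunct2, THEN conjunct2, OF _ _ sm])
    show "(\<lambda>N. a k N) \<longlonglongrightarrow> b k" for k
      unfolding a_def b_def by (intro tendsto_intros jtp_coeff_tendsto assms)
    have "norm (a k N) \<le> C * norm (?f (int_decode k))" for k N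
    proof -
      have "norm (a k N) = norm (jtp_coeff p N (int_decode k)) * norm (?f (int_decode k))"
        by (simp add: a_def norm_mult)
      then show ?thesis using C by (simp add: mult_right_mono)
    qed
    then show "\<forall>\<^sub>F (k, N) in sequentially \<times>\<^sub>F sequentially. norm (a k N) \<le> C * norm (?f (int_decode k))"
      by (intro always_eventually) auto
  qed simp
  moreover have "suminf (\<lambda>k. a k N) = (\<Prod>k<N. theta_factor p x k)" for N
  proof -
    have "((\<lambda>k. a k N) has_sum (\<Prod>k<N. theta_factor p x k)) UNIV"
      unfolding a_def
      using has_sum_reindex_bij_betw[OF bij_int_decode,
          of "\<lambda>j. theta_coeff p j * jtp_coeff p N j * x powi j"]
        finite_jacobi_triple_product[OF assms(1-3)] by simp
    then show ?thesis by (rule has_sum_imp_sums[THEN sums_unique, symmetric])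
  qed
  ultimately have "suminf b = ellE x p"
    using LIMSEQ_unique[OF _ ellE_tendsto[OF assms(1)]] by simp
  have "?f summable_on UNIV" using abs by (rule abs_summable_summable)
  then have hs: "(?f has_sum infsum ?f UNIV) UNIV" by simp
  then have "((\<lambda>k. ?f (int_decode k)) has_sum infsum ?f UNIV) UNIV"
    using has_sum_reindex_bij_betw[OF bij_int_decode, of ?f] by simp
  then have "((\<lambda>k. (1 / L) * ?f (int_decode k)) has_sum (1 / L) * infsum ?f UNIV) UNIV"
    by (rule has_sum_cmult_right)
  then have "(b has_sum (1 / L) * infsum ?f UNIV) UNIV"
    unfolding b_def by (simp add: mult_ac)
  then have "suminf b = (1 / L) * infsum ?f UNIV"
    by (rule has_sum_imp_sums[THEN sums_unique, symmetric])
  then have "infsum ?f UNIV = L * ellE x p"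
    using \<open>suminf b = ellE x p\<close> assms(5) by (simp add: field_simps)
  then show ?thesis using hs by simp
qed

section \<open>The addition formula\<close>

text \<open>The case p = 0 is treated apart from here on, since the recursions for the series
  coefficients use negative powers of p.\<close>

lemma ellE_p0: "x \<noteq> 0 \<Longrightarrow> ellE x 0 = 1 - x"
proof -
  have "theta_factor 0 x k = (if k = 0 then 1 - x else 1)" for k
    by (simp add: theta_factor_def)
  then have "ellE x 0 = (\<Prod>k\<in>{0::nat}. 1 - x)"
    unfolding ellE_prodinf by (subst prodinf_finite[of "{0}"]) auto
  then show ?thesis by simp
qed

lemma jacobi_triple_product':
  assumes "norm p < 1" "p \<noteq> 0"
  obtains L where "L \<noteq> 0"
    "\<And>x. x \<noteq> 0 \<Longrightarrow> ((\<lambda>j. theta_coeff p j * x powi j) has_sum L * ellE x p) UNIV"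
  using qfact_tendsto[OF assms(1)] jacobi_triple_product[OF assms] by metis

text \<open>The substitution j -> 1 - j fixes \<open>tri j\<close> and reverses the sign of (-1)^j
  in the theta series.\<close>

lemma ellE_inverse:
  assumes "norm p < 1" "x \<noteq> 0"
  shows "ellE (1 / x) p = - ellE x p / x"
proof (cases "p = 0")
  case True
  then show ?thesis using assms by (simp add: ellE_p0 field_simps)
next
  case False
  obtain L where L: "L \<noteq> 0" and
    J: "\<And>x. x \<noteq> 0 \<Longrightarrow> ((\<lambda>j. theta_coeff p j * x powi j) has_sum L * ellE x p) UNIV"
    using jacobi_triple_product'[OF assms(1) False] by blast
  have "((\<lambda>j. (- 1 / x) * (theta_coeff p j * x powi j)) has_sum (- 1 / x) * (L * ellE x p)) UNIV"
    using J[OF assms(2)] by (rule has_sum_cmult_right)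
  moreover have "(- 1 / x) * (theta_coeff p j * x powi j)
      = theta_coeff p (1 - j) * (1 / x) powi (1 - j)" for j
  proof -
    have "tri (1 - j) = tri j" using tri_twice[of j] tri_twice[of "1 - j"] by (simp add: algebra_simps)
    moreover have "(- 1 :: complex) powi (1 - j) = - ((- 1) powi j)"
      by (cases "even j") auto
    moreover have "(1 / x) powi (1 - j) = x powi j / x"
      using assms(2) by (simp add: power_int_diff power_int_divide_distrib)
    ultimately show ?thesis by (simp add: theta_coeff_def)
  qed
  ultimately have "((\<lambda>j. theta_coeff p (1 - j) * (1 / x) powi (1 - j)) has_sum (- 1 / x) * (L * ellE x p)) UNIV"
    by simp
  then have "((\<lambda>j. theta_coeff p j * (1 / x) powi j) has_sum (- 1 / x) * (L * ellE x p)) UNIV"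
    by (subst has_sum_reindex_bij_witness[where i = "\<lambda>j. 1 - j" and j = "\<lambda>j. 1 - j"]) auto
  moreover have "((\<lambda>j. theta_coeff p j * (1 / x) powi j) has_sum L * ellE (1 / x) p) UNIV"
    using J[of "1 / x"] assms(2) by simp
  ultimately have "L * ellE (1 / x) p = (- 1 / x) * (L * ellE x p)"
    by (rule has_sum_unique[symmetric])
  then have "L * ellE (1 / x) p = L * (- ellE x p / x)" by simp
  then show ?thesis using L mult_left_cancel by blast
qed

lemma ellE_swap:
  assumes "norm p < 1" "x \<noteq> 0" "y \<noteq> 0"
  shows "ellE (x / y) p = - (x / y) * ellE (y / x) p"
  using ellE_inverse[OF assms(1), of "y / x"] assms by simp

lemma ellE_one: "norm p < 1 \<Longrightarrow> ellE 1 p = 0"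
  unfolding ellE_eq_0_iff theta_factor_def by (rule exI[of _ 0]) simp

text \<open>Away from 0 the triple product expresses \<open>ellE\<close> through
  \<open>partial_theta\<close> at -x and -1/x.\<close>

lemma isCont_ellE:
  assumes "norm p < 1" "x \<noteq> 0"
  shows "isCont (\<lambda>x. ellE x p) x"
proof (cases "p = 0")
  case True
  have "\<forall>\<^sub>F y in nhds x. y \<noteq> 0" using assms(2) by (rule t1_space_nhds)
  then have "\<forall>\<^sub>F y in nhds x. ellE y p = 1 - y"
    by eventually_elim (simp add: True ellE_p0)
  then show ?thesis by (subst isCont_cong) auto
next
  case False
  obtain L where L: "L \<noteq> 0" and
    J: "\<And>x. x \<noteq> 0 \<Longrightarrow> ((\<lambda>j. theta_coeff p j * x powi j) has_sum L * ellE x p) UNIV"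
    using jacobi_triple_product'[OF assms(1) False] by blast
  have "\<forall>\<^sub>F y in nhds x. y \<noteq> 0" using assms(2) by (rule t1_space_nhds)
  then have ev: "\<forall>\<^sub>F y in nhds x. ellE y p
      = (partial_theta p (- y) - y * (partial_theta p (- 1 / y) - 1 + 1 / y)) / L"
  proof eventually_elim
    case (elim y)
    have "L * ellE y p = (\<Sum>\<^sub>\<infinity>j. theta_coeff p j * y powi j)"
      using J[OF elim] by (simp add: infsumI)
    then show ?case
      unfolding theta_series_split(2)[OF assms(1) False elim] using L by (simp add: field_simps)
  qed
  have c: "isCont (\<lambda>y. partial_theta p (f y)) x" if "isCont f x" for f
    by (rule isCont_o2[OF that isCont_partial_theta[OF assms(1)]])
  have "isCont (\<lambda>y. (partial_theta p (- y) - y * (partial_theta p (- 1 / y) - 1 + 1 / y)) / L) x"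
    using assms(2) L by (intro continuous_intros c) auto
  then show ?thesis using isCont_cong[OF ev] by simp
qed

text \<open>A zero makes one factor of the product vanish, which prescribes t^m: two values for each
  factor, with finitely many roots each. Countable exceptional sets suffice later, both for choosing
  an auxiliary point and for arguing by continuity.\<close>

lemma countable_ellE_zeros:
  fixes w p :: complex
  assumes "norm p < 1" "w \<noteq> 0" "m > 0"
  shows "countable {t. t \<noteq> 0 \<and> ellE (w * t ^ m) p = 0}"
proof (rule countable_subset)
  show "{t. t \<noteq> 0 \<and> ellE (w * t ^ m) p = 0}
    \<subseteq> (\<Union>k. {t. t ^ m = 1 / (w * p ^ k)} \<union> {t. t ^ m = p ^ (k + 1) / w})"
  proof
    fix t assume "t \<in> {t. t \<noteq> 0 \<and> ellE (w * t ^ m) p = 0}"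
    then have t: "t \<noteq> 0" "ellE (w * t ^ m) p = 0" by auto
    then obtain k where "theta_factor p (w * t ^ m) k = 0"
      using ellE_eq_0_iff[OF assms(1)] by blast
    then have "w * t ^ m * p ^ k = 1 \<or> p ^ (k + 1) = w * t ^ m"
      using t assms(2) by (auto simp: theta_factor_def)
    then have "t ^ m = 1 / (w * p ^ k) \<or> t ^ m = p ^ (k + 1) / w"
    proof
      assume h: "w * t ^ m * p ^ k = 1"
      then have "w * p ^ k \<noteq> 0" by (metis mult.commute mult.left_commute mult_zero_left zero_neq_one)
      with h show ?thesis by (simp add: field_simps)
    next
      assume "p ^ (k + 1) = w * t ^ m"
      then show ?thesis using assms(2) by (simp add: field_simps)
    qed
    then show "t \<in> (\<Union>k. {t. t ^ m = 1 / (w * p ^ k)} \<union> {t. t ^ m = p ^ (k + 1) / w})" by blast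
  qed
  show "countable (\<Union>k. {t. t ^ m = 1 / (w * p ^ k)} \<union> {t. t ^ m = p ^ (k + 1) / w})"
  proof (rule countable_UN[OF countableI_type])
    show "countable ({t. t ^ m = 1 / (w * p ^ k)} \<union> {t. t ^ m = p ^ (k + 1) / w})" for k
      by (intro countable_Un countable_finite finite_nth_roots assms(3))
  qed
qed

text \<open>In the product of the two theta series, summed over (i, j), put i = s + t, j = s - t if
  i + j is even and i = s + t + 1, j = s - t if it is odd. The quadratic exponent of p then becomes
  a function of s plus a function of t, X occurs only with s, and u only with t. The two parity
  classes yield the two summands.\<close>

lemma ellE_product_rank_two:
  assumes "norm p < 1" "p \<noteq> 0" "a \<noteq> 0"
  obtains P Q \<alpha> \<beta> where
    "\<And>u X. u \<noteq> 0 \<Longrightarrow> X \<noteq> 0 \<Longrightarrow> ellE (u * X) p * ellE (a * X / u) p = P X * \<alpha> u + Q X * \<beta> u"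
proof -
  obtain L where L: "L \<noteq> 0" and
    J: "\<And>x. x \<noteq> 0 \<Longrightarrow> ((\<lambda>j. theta_coeff p j * x powi j) has_sum L * ellE x p) UNIV"
    using jacobi_triple_product'[OF assms(1,2)] by blast
  define P where "P X = (\<Sum>\<^sub>\<infinity>s. p powi (s * s - s) * X powi (2 * s) * a powi s)" for X
  define Q where "Q X = (\<Sum>\<^sub>\<infinity>s. p powi (s * s) * X powi (2 * s + 1) * a powi s)" for X
  define \<alpha> where "\<alpha> u = (\<Sum>\<^sub>\<infinity>t. p powi (t * t) * u powi (2 * t) * a powi (- t)) / L ^ 2" for u
  define \<beta> where "\<beta> u = - (\<Sum>\<^sub>\<infinity>t. p powi (t * t + t) * u powi (2 * t + 1) * a powi (- t)) / L ^ 2" for u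
  have "ellE (u * X) p * ellE (a * X / u) p = P X * \<alpha> u + Q X * \<beta> u"
    if u: "u \<noteq> 0" and X: "X \<noteq> 0" for u X
  proof -
    define f where "f j = theta_coeff p j * (u * X) powi j" for j
    define g where "g j = theta_coeff p j * (a * X / u) powi j" for j
    have nz: "u * X \<noteq> 0" "a * X / u \<noteq> 0" using u X assms(3) by auto
    have sf: "(\<lambda>j. norm (f j)) summable_on UNIV" and sg: "(\<lambda>j. norm (g j)) summable_on UNIV"
      unfolding f_def g_def by (rule theta_series_split(1)[OF assms(1,2)], rule nz)+
    define F where "F = (\<lambda>(i, j). f i * g j)"
    \<comment> \<open>Absolute summability on the plane permits summation by rows as well as over
      the two parity classes.\<close>
    have "(\<lambda>z. norm (F z)) summable_on (UNIV \<times> UNIV)"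
    proof (subst Infinite_Sum.abs_summable_on_Sigma_iff, intro conjI ballI)
      fix i :: int
      show "(\<lambda>j. norm (F (i, j))) summable_on UNIV"
        unfolding F_def using sg by (simp add: norm_mult summable_on_cmult_right)
    next
      have "(\<Sum>\<^sub>\<infinity>j. norm (F (i, j))) = norm (f i) * (\<Sum>\<^sub>\<infinity>j. norm (g j))" for i
        unfolding F_def by (simp add: norm_mult infsum_cmult_right')
      moreover have "(\<Sum>\<^sub>\<infinity>j. norm (g j)) \<ge> 0" by (rule infsum_nonneg) simp
      ultimately show "(\<lambda>i. norm (\<Sum>\<^sub>\<infinity>j. norm (F (i, j)))) summable_on UNIV"
        using sf by (simp add: summable_on_cmult_left norm_mult)
    qed
    then have sF: "F summable_on UNIV \<times> UNIV" by (rule abs_summable_summable)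
    have "infsum F (UNIV \<times> UNIV) = (\<Sum>\<^sub>\<infinity>i. \<Sum>\<^sub>\<infinity>j. F (i, j))"
      by (rule infsum_Sigma_banach[OF sF, symmetric])
    also have "\<dots> = (\<Sum>\<^sub>\<infinity>i. f i) * (\<Sum>\<^sub>\<infinity>j. g j)"
      unfolding F_def by (simp add: infsum_cmult_right' infsum_cmult_left')
    also have "\<dots> = (L * ellE (u * X) p) * (L * ellE (a * X / u) p)"
      unfolding f_def g_def using infsumI[OF J] nz by simp
    finally have total: "infsum F UNIV = L ^ 2 * (ellE (u * X) p * ellE (a * X / u) p)"
      by (simp add: power2_eq_square)
    let ?e = "\<lambda>(s, t). (s + t, s - t) :: int \<times> int"
    let ?o = "\<lambda>(s, t). (s + t + 1, s - t) :: int \<times> int"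
    have inj: "inj ?e" "inj ?o" by (auto simp: inj_on_def)
    have D: "range ?e \<inter> range ?o = {}"
    proof -
      have "(s + t, s - t) \<noteq> (s' + t' + 1, s' - t')" for s t s' t' :: int by auto presburger
      then show ?thesis by auto
    qed
    have U: "UNIV = range ?e \<union> range ?o"
    proof -
      have "(i, j) \<in> range ?e \<union> range ?o" for i j :: int
      proof (cases "even (i + j)")
        case True
        then obtain s where s: "i + j = 2 * s" by blast
        have "(i, j) = ?e (s, i - s)" using s by simp
        then show ?thesis by blast
      next
        case False
        then obtain s where s: "i + j = 2 * s + 1" using oddE by blast
        have "(i, j) = ?o (s, i - s - 1)" using s by simp
        then show ?thesis by blast
      qed
      then show ?thesis by auto
    qed
    have sFe: "F summable_on range ?e" "F summable_on range ?o"
      using summable_on_subset_banach[OF sF] by auto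
    have spl: "infsum F UNIV = infsum F (range ?e) + infsum F (range ?o)"
      using infsum_Un_disjoint[OF sFe D] unfolding U[symmetric] .
    have Fe: "F (?e (s, t)) = (p powi (s * s - s) * X powi (2 * s) * a powi s)
        * (p powi (t * t) * u powi (2 * t) * a powi (- t))" for s t
    proof -
      have "tri (s + t) + tri (s - t) = (s * s - s) + t * t"
        using tri_twice[of "s + t"] tri_twice[of "s - t"] by (simp add: algebra_simps)
      then have "p powi tri (s + t) * p powi tri (s - t) = p powi (s * s - s) * p powi (t * t)"
        using assms(2) by (simp flip: power_int_add)
      moreover have "(- 1 :: complex) powi (s + t) * (- 1) powi (s - t) = 1"
        by (simp flip: power_int_add)
      moreover have "(u * X) powi (s + t) * (a * X / u) powi (s - t)
          = X powi (2 * s) * a powi s * (u powi (2 * t) * a powi (- t))"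
      proof -
        have "(u * X) powi (s + t) * (a * X / u) powi (s - t)
          = (u powi (s + t) / u powi (s - t)) * (X powi (s + t) * X powi (s - t)) * a powi (s - t)"
          by (simp add: power_int_mult_distrib power_int_divide_distrib)
        also have "u powi (s + t) / u powi (s - t) = u powi (2 * t)"
          using u by (simp flip: power_int_diff)
        also have "X powi (s + t) * X powi (s - t) = X powi (2 * s)"
          using X by (simp flip: power_int_add)
        also have "a powi (s - t) = a powi s * a powi (- t)"
          using assms(3) by (simp flip: power_int_add)
        finally show ?thesis by (simp add: mult_ac)
      qed
      moreover have "F (?e (s, t)) = ((- 1) powi (s + t) * (- 1) powi (s - t)) * (p powi tri (s + t) * p powi tri (s - t)) *
         ((u * X) powi (s + t) * (a * X / u) powi (s - t))"
        unfolding F_def f_def g_def theta_coeff_def by (simp add: mult_ac)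
      ultimately show ?thesis by (simp add: mult_ac)
    qed
    have Fo: "F (?o (s, t)) = - (p powi (s * s) * X powi (2 * s + 1) * a powi s)
        * (p powi (t * t + t) * u powi (2 * t + 1) * a powi (- t))" for s t
    proof -
      have "tri (s + t + 1) + tri (s - t) = s * s + (t * t + t)"
        using tri_twice[of "s + t + 1"] tri_twice[of "s - t"] by (simp add: algebra_simps)
      then have "p powi tri (s + t + 1) * p powi tri (s - t) = p powi (s * s) * p powi (t * t + t)"
        using assms(2) by (simp flip: power_int_add)
      moreover have "(- 1 :: complex) powi (s + t + 1) * (- 1) powi (s - t) = - 1"
        by (simp flip: power_int_add)
      moreover have "(u * X) powi (s + t + 1) * (a * X / u) powi (s - t)
          = X powi (2 * s + 1) * a powi s * (u powi (2 * t + 1) * a powi (- t))"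
      proof -
        have "(u * X) powi (s + t + 1) * (a * X / u) powi (s - t)
          = (u powi (s + t + 1) / u powi (s - t)) * (X powi (s + t + 1) * X powi (s - t)) * a powi (s - t)"
          by (simp add: power_int_mult_distrib power_int_divide_distrib)
        also have "u powi (s + t + 1) / u powi (s - t) = u powi (2 * t + 1)"
          using u by (simp flip: power_int_diff)
        also have "X powi (s + t + 1) * X powi (s - t) = X powi (2 * s + 1)"
          using X by (simp flip: power_int_add)
        also have "a powi (s - t) = a powi s * a powi (- t)"
          using assms(3) by (simp flip: power_int_add)
        finally show ?thesis by (simp add: mult_ac)
      qed
      moreover have "F (?o (s, t)) = ((- 1) powi (s + t + 1) * (- 1) powi (s - t)) * (p powi tri (s + t + 1) * p powi tri (s - t)) *
         ((u * X) powi (s + t + 1) * (a * X / u) powi (s - t))"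
        unfolding F_def f_def g_def theta_coeff_def by (simp add: mult_ac)
      ultimately show ?thesis by (simp add: mult_ac)
    qed
    have "infsum F (range ?e) = infsum (F \<circ> ?e) UNIV"
      by (rule infsum_reindex[OF inj(1)])
    also have "\<dots> = (\<Sum>\<^sub>\<infinity>s. \<Sum>\<^sub>\<infinity>t. (F \<circ> ?e) (s, t))"
      using infsum_Sigma_banach[of "F \<circ> ?e" UNIV "\<lambda>_. UNIV"] sFe(1) summable_on_reindex[OF inj(1), of F] by simp
    also have "\<dots> = (\<Sum>\<^sub>\<infinity>s. p powi (s * s - s) * X powi (2 * s) * a powi s)
       * (\<Sum>\<^sub>\<infinity>t. p powi (t * t) * u powi (2 * t) * a powi (- t))"
      unfolding o_def Fe by (simp only: infsum_cmult_right' infsum_cmult_left')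
    finally have e: "infsum F (range ?e) = L ^ 2 * (P X * \<alpha> u)"
      unfolding P_def \<alpha>_def using L by simp
    have "infsum F (range ?o) = infsum (F \<circ> ?o) UNIV"
      by (rule infsum_reindex[OF inj(2)])
    also have "\<dots> = (\<Sum>\<^sub>\<infinity>s. \<Sum>\<^sub>\<infinity>t. (F \<circ> ?o) (s, t))"
      using infsum_Sigma_banach[of "F \<circ> ?o" UNIV "\<lambda>_. UNIV"] sFe(2) summable_on_reindex[OF inj(2), of F] by simp
    also have "\<dots> = - (\<Sum>\<^sub>\<infinity>s. p powi (s * s) * X powi (2 * s + 1) * a powi s)
       * (\<Sum>\<^sub>\<infinity>t. p powi (t * t + t) * u powi (2 * t + 1) * a powi (- t))"
      unfolding o_def Fo by (simp only: infsum_cmult_right' infsum_cmult_left' infsum_uminus)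
    finally have o: "infsum F (range ?o) = L ^ 2 * (Q X * \<beta> u)"
      unfolding Q_def \<beta>_def using L by simp
    show ?thesis
      using spl[unfolded total e o] L by (simp flip: distrib_left)
  qed
  then show thesis by (rule that)
qed

text \<open>Both sides are rank-one kernels in the pairs \<open>(u, v)\<close> and \<open>(X, Y)\<close>;
  the constant is fixed by the specialisation \<open>X = 1 / v\<close>.\<close>
theorem ellE_addition:
  assumes "norm p < 1" "a \<noteq> 0" "u \<noteq> 0" "v \<noteq> 0" "X \<noteq> 0" "Y \<noteq> 0"
  shows "ellE (u * X) p * ellE (a * X / u) p * (ellE (v * Y) p * ellE (a * Y / v) p)
       - ellE (u * Y) p * ellE (a * Y / u) p * (ellE (v * X) p * ellE (a * X / v) p)
       = u * Y * ellE (v / u) p * ellE (a / (u * v)) p * ellE (X / Y) p * ellE (a * X * Y) p"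
proof (cases "p = 0")
  case True
  \<comment> \<open>For p = 0 the theta functions are linear; eliminating a in favour of s turns the
    quotients a / u and a / v into products.\<close>
  define s where "s = a / (u * v)"
  have a: "a = s * u * v" using assms by (simp add: s_def)
  have "s \<noteq> 0" using assms by (simp add: s_def)
  have uY: "u * Y * (1 - v / u) * (1 - X / Y) = (u - v) * (Y - X)"
    using assms by (simp add: field_simps)
  have "u * Y * (1 - v / u) * (1 - s) * (1 - X / Y) * (1 - a * X * Y)
    = (u - v) * (Y - X) * (1 - s) * (1 - a * X * Y)"
    using arg_cong[OF uY, of "\<lambda>z. z * ((1 - s) * (1 - a * X * Y))"] by (simp only: mult_ac)
  moreover have "a * Z / u = s * v * Z" "a * Z / v = s * u * Z" for Z
    using assms unfolding a by simp_all
  ultimately show ?thesis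
    using assms \<open>s \<noteq> 0\<close> unfolding True s_def[symmetric]
    by (simp add: ellE_p0) (simp add: a algebra_simps)
next
  case False
  obtain P Q \<alpha> \<beta> where R:
    "\<And>u X. u \<noteq> 0 \<Longrightarrow> X \<noteq> 0 \<Longrightarrow> ellE (u * X) p * ellE (a * X / u) p = P X * \<alpha> u + Q X * \<beta> u"
    using ellE_product_rank_two[OF assms(1) False assms(2)] by metis
  define D where "D u v X Y = ellE (u * X) p * ellE (a * X / u) p * (ellE (v * Y) p * ellE (a * Y / v) p)
       - ellE (u * Y) p * ellE (a * Y / u) p * (ellE (v * X) p * ellE (a * X / v) p)" for u v X Y
  have D: "D u v X Y = (\<alpha> u * \<beta> v - \<alpha> v * \<beta> u) * (P X * Q Y - P Y * Q X)"
    if "u \<noteq> 0" "v \<noteq> 0" "X \<noteq> 0" "Y \<noteq> 0" for u v X Y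
    unfolding D_def R[OF that(1,3)] R[OF that(2,4)] R[OF that(1,4)] R[OF that(2,3)]
    by (simp add: algebra_simps)
  let ?Z = "\<lambda>w. {t. t \<noteq> 0 \<and> ellE (w * t ^ 1) p = 0}"
  \<comment> \<open>The auxiliary point w has to avoid the zeros of four theta factors; their
    product is, up to a nonzero factor, the value of D that is cancelled at the end.\<close>
  define B where "B = {0} \<union> (?Z (1 / v) \<union> ?Z (v / a) \<union> ?Z X \<union> ?Z (1 / (a * X)))"
  have "countable B"
    unfolding B_def by (intro countable_Un countable_ellE_zeros) (use assms in auto)
  then have "B \<noteq> UNIV" using uncountable_UNIV_complex by metis
  then obtain w where w: "w \<notin> B" by blast
  then have w0: "w \<noteq> 0" by (simp add: B_def)
  have wz: "ellE (w / v) p \<noteq> 0" "ellE (w * v / a) p \<noteq> 0" "ellE (w * X) p \<noteq> 0" "ellE (w / (a * X)) p \<noteq> 0"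
    using w w0 by (simp_all add: B_def mult_ac)
  note S = ellE_swap[OF assms(1)]
  have wz': "ellE (a / (w * v)) p \<noteq> 0" "ellE (a * X / w) p \<noteq> 0"
    using wz S[of a "w * v"] S[of "a * X" w] assms w0 by simp_all
  have args: "w * (1 / v) = w / v" "a * (1 / v) / w = a / (w * v)" "1 / X * (1 / w) = 1 / (w * X)"
    "a * (1 / w) / (1 / X) = a * X / w" "w * (1 / w) = 1" "u * (1 / v) = u / v"
    "a * (1 / v) / u = a / (u * v)" "v * (1 / w) = v / w" "a * (1 / w) / v = a / (w * v)"
    "v * (1 / v) = 1" "1 / X * Y = Y / X" "a * Y / (1 / X) = a * X * Y" "1 / X * X = 1"
    using assms w0 by simp_all
  \<comment> \<open>D is a function of (u, v) times a function of (X, Y), so the second pairs of two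
    values of D may be exchanged. In each of the three other values one of the two products contains
    \<open>ellE 1 p = 0\<close>, which leaves a single theta product.\<close>
  have "D u v X Y * D w (1 / X) (1 / v) (1 / w) = D u v (1 / v) (1 / w) * D w (1 / X) X Y"
    using assms w0 by (simp add: D)
  moreover have "D w (1 / X) (1 / v) (1 / w) = ellE (w / v) p * ellE (a / (w * v)) p
      * (- (ellE (w * X) p / (w * X)) * ellE (a * X / w) p)"
    using ellE_inverse[OF assms(1), of "w * X"] assms w0
    unfolding D_def args by (simp add: ellE_one)
  moreover have "D u v (1 / v) (1 / w) = ellE (u / v) p * ellE (a / (u * v)) p
      * (- (v / w) * ellE (w / v) p * ellE (a / (w * v)) p)"
    using S[of v w] assms w0
    unfolding D_def args by (simp add: ellE_one)
  moreover have "D w (1 / X) X Y = ellE (w * X) p * ellE (a * X / w) p * (ellE (Y / X) p * ellE (a * X * Y) p)"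
    unfolding D_def args by (simp add: ellE_one assms(1))
  moreover have cancel: "d = v * X * f * g * h * k"
    if eq: "d * z = f * g * (- (v / w) * A * B) * (C * E * (h * k))"
      and z: "z = A * B * (- (C / (w * X)) * E)"
      and nz: "A \<noteq> 0" "B \<noteq> 0" "C \<noteq> 0" "E \<noteq> 0" for d z A B C E f g h k :: complex
  proof -
    have "f * g * (- (v / w) * A * B) * (C * E * (h * k)) = v * X * f * g * h * k * z"
      unfolding z using assms(5) w0 by simp
    moreover have "z \<noteq> 0" unfolding z using nz assms(5) w0 by simp
    ultimately show ?thesis using eq by simp
  qed
  ultimately have "D u v X Y = v * X * ellE (u / v) p * ellE (a / (u * v)) p * ellE (Y / X) p * ellE (a * X * Y) p"
    by (intro cancel[OF _ _ wz(1) wz'(1) wz(3) wz'(2)]) simp_all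
  also have "\<dots> = (v * ellE (u / v) p) * (X * ellE (Y / X) p) * ellE (a / (u * v)) p * ellE (a * X * Y) p"
    by (simp add: mult_ac)
  also have "v * ellE (u / v) p = - (u * ellE (v / u) p)"
    using S[of u v] assms by simp
  also have "X * ellE (Y / X) p = - (Y * ellE (X / Y) p)"
    using S[of Y X] assms by simp
  finally show ?thesis unfolding D_def by (simp add: mult_ac)
qed

section \<open>The Frenkel--Turaev summation\<close>

locale elliptic_nome =
  fixes p q :: complex
  assumes norm_p: "norm p < 1" and q_nz: "q \<noteq> 0"
begin

abbreviation E :: "complex \<Rightarrow> complex" where "E x \<equiv> ellE x p"

definition P :: "complex \<Rightarrow> nat \<Rightarrow> complex" where
  "P a k = (\<Prod>i<k. E (a * q ^ i))"

lemma ellpoch_eq_P: "ellpoch a q p (int k) = P a k"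
  by (simp add: ellpoch_def P_def)

lemma P_0 [simp]: "P a 0 = 1"
  by (simp add: P_def)

lemma P_Suc: "P a (Suc k) = P a k * E (a * q ^ k)"
  by (simp add: P_def)

lemma P_add: "P a (k + m) = P a k * P (a * q ^ k) m"
  by (induction m) (simp_all add: P_Suc power_add mult_ac)

lemma P_Suc_left: "P a (Suc k) = E a * P (a * q) k"
  using P_add[of a 1 k] by (simp add: P_def)

lemma E_swap: "x \<noteq> 0 \<Longrightarrow> y \<noteq> 0 \<Longrightarrow> E (x / y) = - (x / y) * E (y / x)"
  using ellE_swap[OF norm_p] .

lemma E_inverse: "x \<noteq> 0 \<Longrightarrow> E (1 / x) = - E x / x"
  using ellE_inverse[OF norm_p] .

lemma E_addition:
  assumes "a \<noteq> 0" "u \<noteq> 0" "v \<noteq> 0" "X \<noteq> 0" "Y \<noteq> 0"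
  shows "E (u * X) * E (a * X / u) * (E (v * Y) * E (a * Y / v))
       - E (u * Y) * E (a * Y / u) * (E (v * X) * E (a * X / v))
       = u * Y * E (v / u) * E (a / (u * v)) * E (X / Y) * E (a * X * Y)"
  using ellE_addition[OF norm_p assms] .

text \<open>The summand of the very-well-poised elliptic hypergeometric series usually written 10V9;
  the parameter \<open>1 / q ^ N\<close> makes the series terminate.\<close>

definition ft_term :: "complex \<Rightarrow> complex \<Rightarrow> complex \<Rightarrow> complex \<Rightarrow> complex \<Rightarrow> nat \<Rightarrow> nat \<Rightarrow> complex" where
  "ft_term a b c d e N k = E (a * q ^ (2 * k)) / E a
     * (P a k * P b k * P c k * P d k * P e k * P (1 / q ^ N) k * q ^ k)
     / (P q k * P (a * q / b) k * P (a * q / c) k * P (a * q / d) k * P (a * q / e) k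
        * P (a * q ^ (N + 1)) k)"

definition ft_rhs :: "complex \<Rightarrow> complex \<Rightarrow> complex \<Rightarrow> complex \<Rightarrow> nat \<Rightarrow> complex" where
  "ft_rhs a b c d N = P (a * q) N * P (a * q / (b * c)) N * P (a * q / (b * d)) N * P (a * q / (c * d)) N
     / (P (a * q / b) N * P (a * q / c) N * P (a * q / d) N * P (a * q / (b * c * d)) N)"

text \<open>All integer shifts of a are included so that the condition survives the parameter change
  of the induction. The last quotient also controls \<open>a q^i / e\<close>, which under the
  balancing condition is the reciprocal of such a quotient.\<close>

definition ft_generic :: "complex \<Rightarrow> complex \<Rightarrow> complex \<Rightarrow> complex \<Rightarrow> bool" where
  "ft_generic a b c d \<longleftrightarrow> a \<noteq> 0 \<and> b \<noteq> 0 \<and> c \<noteq> 0 \<and> d \<noteq> 0 \<and>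
     (\<forall>j::int. E (a * q powi j) \<noteq> 0 \<and> E (a * q powi j / b) \<noteq> 0 \<and> E (a * q powi j / c) \<noteq> 0
       \<and> E (a * q powi j / d) \<noteq> 0 \<and> E (a * q powi j / (b * c * d)) \<noteq> 0)"

lemma ft_generic_shift:
  assumes "ft_generic a b c d"
  shows "ft_generic (a * q ^ 2) (b * q) (c * q) (d * q)"
proof -
  have args: "a * q ^ 2 * q powi j = a * q powi (j + 2)" "a * q powi (j + 2) / (b * q) = a * q powi (j + 1) / b"
    "a * q powi (j + 2) / (c * q) = a * q powi (j + 1) / c"
    "a * q powi (j + 2) / (d * q) = a * q powi (j + 1) / d"
    "a * q powi (j + 2) / (b * q * (c * q) * (d * q)) = a * q powi (j - 1) / (b * c * d)" for j :: int
    using q_nz by (simp_all add: power_int_add power_int_diff power2_eq_square)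
  show ?thesis
    using assms q_nz unfolding ft_generic_def args by simp
qed

lemma ft_generic_power:
  assumes "ft_generic a b c d"
  shows "E (a * q ^ i) \<noteq> 0" "E (a * q ^ i / b) \<noteq> 0" "E (a * q ^ i / c) \<noteq> 0" "E (a * q ^ i / d) \<noteq> 0"
    "E (a * q ^ i / (b * c * d)) \<noteq> 0"
  using assms unfolding ft_generic_def by (metis power_int_of_nat)+

text \<open>What is left of the difference of two summands once the other factors are regrouped into
  the summand at k - 1 with shifted a, b, c, d. The inner product with e comes from the right-hand
  side of the addition formula.\<close>

definition ft_shift_coeff :: "complex \<Rightarrow> complex \<Rightarrow> complex \<Rightarrow> complex \<Rightarrow> complex \<Rightarrow> nat \<Rightarrow> complex" where
  "ft_shift_coeff a b c d e N = E (a * q) * E (a * q ^ 2) * E b * E c * E d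
     * (e * (E (1 / (q ^ N * e)) * E (a * q ^ (N + 2) / e)))
     / (E (a * q / b) * E (a * q / c) * E (a * q / d) * E (a * q / e) * E (a * q ^ 2 / e)
        * E (a * q ^ (N + 1)) * E (a * q ^ (N + 2)))"

text \<open>The factors of the \<open>N\<close>-dependence at argument \<open>k\<close> are three theta products of the shape
  \<open>E (u q\<^sup>k) E (a q\<^sup>k / u)\<close> with \<open>u = e / q, q\<^sup>-\<^sup>N\<^sup>-\<^sup>1, 1\<close>, which are linearly dependent.\<close>
lemma ft_term_Suc:
  assumes gen: "ft_generic a b c d" and e: "e \<noteq> 0"
    and e_gen: "E (a * q / e) \<noteq> 0" "E (a * q ^ 2 / e) \<noteq> 0"
    and qk: "E (q ^ Suc j) \<noteq> 0"
    and P_e: "P (a * q ^ 3 / e) j \<noteq> 0"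
    and P_q: "P q j \<noteq> 0"
  shows "ft_term a b c d e (Suc N) (Suc j) = ft_term a b c d (e / q) N (Suc j)
    + ft_shift_coeff a b c d e N * ft_term (a * q ^ 2) (b * q) (c * q) (d * q) e N j"
proof -
  note g = ft_generic_power[OF gen]
  have nz: "a \<noteq> 0" "b \<noteq> 0" "c \<noteq> 0" "d \<noteq> 0" using gen by (auto simp: ft_generic_def)
  note q = q_nz
  have Pnz: "P (a * q ^ i) k \<noteq> 0" "P (a * q ^ i / b) k \<noteq> 0" "P (a * q ^ i / c) k \<noteq> 0" "P (a * q ^ i / d) k \<noteq> 0"
    for i k
    using g[of "i + _"] by (auto simp: P_def power_add mult_ac)
  define X where "X = q ^ Suc j"
  have X: "X \<noteq> 0" using q by (simp add: X_def)
  define v where "v = 1 / q ^ Suc N"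
  have v: "v \<noteq> 0" using q by (simp add: v_def)
  define K where "K = E (1 / (q ^ N * e)) * E (a * q ^ (N + 2) / e)"
  \<comment> \<open>The addition formula at Y = 1: factors at k = j + 1 belong to X = q^k, their
    values at k = 0 to Y.\<close>
  have "E (e / q * X) * E (a * X / (e / q)) * (E v * E (a / v))
     - E (e / q) * E (a / (e / q)) * (E (v * X) * E (a * X / v))
     = e / q * E (v / (e / q)) * E (a / (e / q * v)) * E X * E (a * X)"
    using E_addition[of a "e / q" v X 1] nz e q X v by simp
  moreover have "e / q * X = e * q ^ j" "a * X / (e / q) = a * q ^ (j + 2) / e"
    "a / v = a * q ^ (N + 1)" "a / (e / q) = a * q / e" "v * X = 1 / q ^ N * q ^ j"
    "a * X / v = a * q ^ (N + 2) * q ^ j" "v / (e / q) = 1 / (q ^ N * e)"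
    "a / (e / q * v) = a * q ^ (N + 2) / e" "a * X = a * q * q ^ j"
    using q e nz by (simp_all add: X_def v_def power_add power2_eq_square)
  ultimately have add: "E (e * q ^ j) * E (a * q ^ (j + 2) / e) * (E (1 / q ^ Suc N) * E (a * q ^ (N + 1)))
     - E (e / q) * E (a * q / e) * (E (1 / q ^ N * q ^ j) * E (a * q ^ (N + 2) * q ^ j))
     = e / q * K * E (q ^ Suc j) * E (a * q * q ^ j)"
    unfolding K_def v_def X_def by (simp only: mult.assoc)
  have l: "P x (Suc j) = E x * P y j" if "x * q = y" for x y
    using that by (simp add: P_Suc_left)
  have G3: "E (a * q ^ 2 / e) * P (a * q ^ 3 / e) j = P (a * q ^ 2 / e) j * E (a * q ^ (j + 2) / e)"
    using P_Suc[of "a * q ^ 2 / e" j] l[of "a * q ^ 2 / e" "a * q ^ 3 / e"]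
    by (simp add: power_add power2_eq_square power3_eq_cube mult_ac)
  then have G3nz: "E (a * q ^ (j + 2) / e) \<noteq> 0" using e_gen(2) P_e by auto
  have Pe2: "P (a * q ^ 2 / e) j = E (a * q ^ 2 / e) * P (a * q ^ 3 / e) j / E (a * q ^ (j + 2) / e)"
    using G3 G3nz by simp
  have Ejnz: "E (a * q * q ^ j) \<noteq> 0" using g(1)[of "Suc j"] by (simp add: mult_ac)
  have Pa1: "P (a * q) j = E (a * q) * P (a * q ^ 2) j / E (a * q * q ^ j)"
    using P_Suc[of "a * q" j] l[of "a * q" "a * q ^ 2"] Ejnz
    by (simp add: power2_eq_square mult_ac)
  have H3nz: "E (a * q ^ (N + 2) * q ^ j) \<noteq> 0"
    using g(1)[of "N + 2 + j"] by (simp add: power_add mult_ac)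
  have "a * q ^ (N + 2) * q = a * q ^ (N + 3)"
    by (simp add: power_add power2_eq_square power3_eq_cube)
  then have "P (a * q ^ (N + 2)) j * E (a * q ^ (N + 2) * q ^ j) = E (a * q ^ (N + 2)) * P (a * q ^ (N + 3)) j"
    using P_Suc[of "a * q ^ (N + 2)" j] l[of "a * q ^ (N + 2)" "a * q ^ (N + 3)"] by metis
  then have PN: "P (a * q ^ (N + 2)) j = E (a * q ^ (N + 2)) * P (a * q ^ (N + 3)) j / E (a * q ^ (N + 2) * q ^ j)"
    by (rule eq_divide_imp[OF H3nz])
  have L: "P a (Suc j) = E a * P (a * q) j" "P b (Suc j) = E b * P (b * q) j" "P c (Suc j) = E c * P (c * q) j"
    "P d (Suc j) = E d * P (d * q) j" "P (e / q) (Suc j) = E (e / q) * P e j"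
    "P (1 / q ^ Suc N) (Suc j) = E (1 / q ^ Suc N) * P (1 / q ^ N) j"
    "P (a * q / b) (Suc j) = E (a * q / b) * P (a * q ^ 2 / b) j"
    "P (a * q / c) (Suc j) = E (a * q / c) * P (a * q ^ 2 / c) j"
    "P (a * q / d) (Suc j) = E (a * q / d) * P (a * q ^ 2 / d) j"
    "P (a * q / e) (Suc j) = E (a * q / e) * P (a * q ^ 2 / e) j"
    "P (a * q ^ (N + 1)) (Suc j) = E (a * q ^ (N + 1)) * P (a * q ^ (N + 2)) j"
    "P (a * q ^ (Suc N + 1)) (Suc j) = E (a * q ^ (N + 2)) * P (a * q ^ (N + 3)) j"
    using q by (auto intro!: l simp: power_add power2_eq_square power3_eq_cube)
  have Le: "P (a * q / (e / q)) (Suc j) = E (a * q ^ 2 / e) * P (a * q ^ 3 / e) j"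
  proof -
    have "a * q / (e / q) = a * q ^ 2 / e" by (simp add: power2_eq_square)
    moreover have "P (a * q ^ 2 / e) (Suc j) = E (a * q ^ 2 / e) * P (a * q ^ 3 / e) j"
      by (rule l) (simp add: power2_eq_square power3_eq_cube)
    ultimately show ?thesis by (simp only:)
  qed
  have Pq: "P q (Suc j) = P q j * E (q ^ Suc j)" "P e (Suc j) = P e j * E (e * q ^ j)"
    "P (1 / q ^ N) (Suc j) = P (1 / q ^ N) j * E (1 / q ^ N * q ^ j)"
    by (simp_all add: P_Suc)
  have sh: "a * q ^ 2 * q ^ (2 * j) = a * q ^ (2 * Suc j)"
    "a * q ^ 2 * q = a * q ^ 3" "a * q ^ 3 / (b * q) = a * q ^ 2 / b"
    "a * q ^ 3 / (c * q) = a * q ^ 2 / c" "a * q ^ 3 / (d * q) = a * q ^ 2 / d"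
    "a * q ^ 2 * q ^ (N + 1) = a * q ^ (N + 3)"
    using q by (simp_all add: power_add power2_eq_square power3_eq_cube)
  \<comment> \<open>Theta values and factorials are abstracted to independent variables. The three
    summands share the factor W, and the addition formula divided by \<open>G1 * H1\<close> is the
    relation between their cofactors.\<close>
  have combine: "T / Ea * (Ea * (E1 * pa / Ej) * (Eb * pb) * (Ec * pc) * (Ed * pd) * (pe * Eej) * (En * pn) * (q * Q))
      / ((pq * Eq) * (Fb * db) * (Fc * dc) * (Fd * dd) * (G1 * (G2 * de / G3)) * (H2 * dz))
    = T / Ea * (Ea * (E1 * pa / Ej) * (Eb * pb) * (Ec * pc) * (Ed * pd) * (Ee * pe) * (pn * Enj) * (q * Q))
      / ((pq * Eq) * (Fb * db) * (Fc * dc) * (Fd * dd) * (G2 * de) * (H1 * (H2 * dz / H3)))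
     + E1 * E2 * Eb * Ec * Ed * (e * k) / (Fb * Fc * Fd * G1 * G2 * H1 * H2)
      * (T / E2 * (pa * pb * pc * pd * pe * pn * Q) / (pq * db * dc * dd * de * dz))"
    if add: "Eej * G3 * (En * H1) - Ee * G1 * (Enj * H3) = e / q * k * Eq * Ej"
      and nz: "Ea \<noteq> 0" "E2 \<noteq> 0" "Ej \<noteq> 0" "Eq \<noteq> 0" "G1 \<noteq> 0" "G2 \<noteq> 0" "G3 \<noteq> 0" "H1 \<noteq> 0"
        "H2 \<noteq> 0" "H3 \<noteq> 0"
    for T Ea E1 E2 pa Ej Eb Ec Ed pb pc pd pe Eej Ee En Enj pn Q pq Eq Fb Fc Fd db dc dd de dz G1 G2 G3 H1 H2 H3 k :: complex
  proof -
    define W where "W = T * E1 * pa * (Eb * Ec * Ed) * (pb * pc * pd) * pe * pn * q * Q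
       / (Ej * pq * Eq * (Fb * Fc * Fd) * (db * dc * dd) * de * G2 * H2 * dz)"
    have 1: "T / Ea * (Ea * (E1 * pa / Ej) * (Eb * pb) * (Ec * pc) * (Ed * pd) * (pe * Eej) * (En * pn) * (q * Q))
      / ((pq * Eq) * (Fb * db) * (Fc * dc) * (Fd * dd) * (G1 * (G2 * de / G3)) * (H2 * dz))
      = W * (Eej * En * G3 / G1)"
      using nz unfolding W_def by (simp add: mult_ac)
    have 2: "T / Ea * (Ea * (E1 * pa / Ej) * (Eb * pb) * (Ec * pc) * (Ed * pd) * (Ee * pe) * (pn * Enj) * (q * Q))
      / ((pq * Eq) * (Fb * db) * (Fc * dc) * (Fd * dd) * (G2 * de) * (H1 * (H2 * dz / H3)))
      = W * (Ee * Enj * H3 / H1)"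
      using nz unfolding W_def by (simp add: mult_ac)
    have 3: "E1 * E2 * Eb * Ec * Ed * (e * k) / (Fb * Fc * Fd * G1 * G2 * H1 * H2)
      * (T / E2 * (pa * pb * pc * pd * pe * pn * Q) / (pq * db * dc * dd * de * dz))
      = W * (e / q * k * Eq * Ej / (G1 * H1))"
      using nz q unfolding W_def by (simp add: mult_ac)
    have "Eej * En * G3 / G1 = Ee * Enj * H3 / H1 + e / q * k * Eq * Ej / (G1 * H1)"
      using nz unfolding add[symmetric] by (simp add: field_simps)
    then show ?thesis unfolding 1 2 3 by (simp add: distrib_left)
  qed
  show ?thesis
    unfolding ft_term_def ft_shift_coeff_def sh L Le Pq Pa1 Pe2 PN power_Suc[of q j]
    by (rule combine[OF add[unfolded K_def power_Suc[of q j]]])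
       (use g(1)[of 0] g(1)[of 2] g(1)[of "N + 1"] g(1)[of "N + 2"] Ejnz G3nz H3nz e_gen qk in simp_all)
qed

text \<open>The closed form obeys the recursion of the summands: after common factorials are
  cancelled, a single relation between theta products remains, in \<open>y = a q^(N+1)\<close> and
  \<open>s = b c d\<close>.\<close>

lemma ft_rhs_Suc:
  assumes gen: "ft_generic a b c d" and e: "e = a ^ 2 * q ^ (N + 2) / (b * c * d)"
  shows "ft_rhs a b c d (Suc N) = ft_rhs a b c d N
    + ft_shift_coeff a b c d e N * ft_rhs (a * q ^ 2) (b * q) (c * q) (d * q) N"
proof -
  note g = ft_generic_power[OF gen]
  have nz: "a \<noteq> 0" "b \<noteq> 0" "c \<noteq> 0" "d \<noteq> 0" using gen by (auto simp: ft_generic_def)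
  note q = q_nz
  define s where "s = b * c * d"
  define y where "y = a * q ^ (N + 1)"
  have s: "s \<noteq> 0" and y: "y \<noteq> 0" and e0: "e \<noteq> 0" using nz q by (auto simp: s_def y_def e)
  have ey: "e = a * y * q / s" by (simp add: e s_def y_def power2_eq_square)
  \<comment> \<open>The addition formula with base y^2 / (c d), u = y, v = y / c, X = 1 and Y = 1 /
    b, after which \<open>E (1 / c)\<close> and \<open>E (1 / d)\<close> are reflected.\<close>
  have W: "E y * E (y / (b * c)) * E (y / (b * d)) * E (y / (c * d))
      - E (y / b) * E (y / c) * E (y / d) * E (y / s) = y / s * E b * E c * E d * E (y ^ 2 / s)"
  proof -
    have "E (y * 1) * E (y ^ 2 / (c * d) * 1 / y) * (E (y / c * (1 / b)) * E (y ^ 2 / (c * d) * (1 / b) / (y / c)))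
       - E (y * (1 / b)) * E (y ^ 2 / (c * d) * (1 / b) / y) * (E (y / c * 1) * E (y ^ 2 / (c * d) * 1 / (y / c)))
       = y * (1 / b) * E (y / c / y) * E (y ^ 2 / (c * d) / (y * (y / c))) * E (1 / (1 / b)) * E (y ^ 2 / (c * d) * 1 * (1 / b))"
      by (rule E_addition) (use nz y in auto)
    moreover have "y * 1 = y" "y ^ 2 / (c * d) * 1 / y = y / (c * d)" "y / c * (1 / b) = y / (b * c)"
      "y ^ 2 / (c * d) * (1 / b) / (y / c) = y / (b * d)" "y * (1 / b) = y / b"
      "y ^ 2 / (c * d) * (1 / b) / y = y / s" "y / c * 1 = y / c" "y ^ 2 / (c * d) * 1 / (y / c) = y / d"
      "y / c / y = 1 / c" "y ^ 2 / (c * d) / (y * (y / c)) = 1 / d" "1 / (1 / b) = b"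
      "y ^ 2 / (c * d) * 1 * (1 / b) = y ^ 2 / s"
      using nz y by (simp_all add: s_def power2_eq_square)
    ultimately have "E y * E (y / (c * d)) * (E (y / (b * c)) * E (y / (b * d)))
       - E (y / b) * E (y / s) * (E (y / c) * E (y / d))
       = y / b * E (1 / c) * E (1 / d) * E b * E (y ^ 2 / s)" by (simp only:)
    also have "\<dots> = y / s * E b * E c * E d * E (y ^ 2 / s)"
      using nz by (simp add: E_inverse s_def)
    finally show ?thesis by (simp add: mult_ac)
  qed
  have l: "E x * P z N = P x N * E (x * q ^ N)" if "x * q = z" for x z
    using P_Suc[of x N] P_Suc_left[of x N] that by simp
  have args: "a * q ^ 2 * q = a * q ^ 3" "a * q ^ 3 / (b * q * (c * q)) = a * q / (b * c)"
    "a * q ^ 3 / (b * q * (d * q)) = a * q / (b * d)" "a * q ^ 3 / (c * q * (d * q)) = a * q / (c * d)"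
    "a * q ^ 3 / (b * q) = a * q ^ 2 / b" "a * q ^ 3 / (c * q) = a * q ^ 2 / c"
    "a * q ^ 3 / (d * q) = a * q ^ 2 / d" "a * q ^ 3 / (b * q * (c * q) * (d * q)) = a / s"
    using q by (simp_all add: s_def power2_eq_square power3_eq_cube)
  have args': "a * q * q ^ N = y" "a * q / x * q ^ N = y / x" for x
    by (simp_all add: y_def)
  have D: "P (a * q ^ 2 / x) N = P (a * q / x) N * E (y / x) / E (a * q / x)" if "E (a * q / x) \<noteq> 0" for x
  proof (rule eq_divide_imp[OF that])
    have "a * q / x * q = a * q ^ 2 / x" by (simp add: power2_eq_square)
    from l[OF this] show "P (a * q ^ 2 / x) N * E (a * q / x) = P (a * q / x) N * E (y / x)"
      unfolding args' by (simp only: mult.commute)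
  qed
  have A: "P (a * q ^ 3) N = P (a * q) N * E y * E (a * q ^ (N + 2)) / (E (a * q) * E (a * q ^ 2))"
  proof -
    have "E (a * q) * (E (a * q ^ 2) * P (a * q ^ 3) N) = E (a * q) * (P (a * q ^ 2) N * E (a * q ^ 2 * q ^ N))"
      by (subst l) (simp_all add: power2_eq_square power3_eq_cube)
    also have "\<dots> = (E (a * q) * P (a * q ^ 2) N) * E (a * q ^ (N + 2))"
      by (simp add: power_add power2_eq_square mult_ac)
    also have "\<dots> = P (a * q) N * E y * E (a * q ^ (N + 2))"
      by (subst l) (simp_all add: power2_eq_square args')
    finally show ?thesis using g(1)[of 1] g(1)[of 2] by (simp add: eq_divide_eq mult_ac)
  qed
  have S: "P (a / s) N = E (a / s) * P (a * q / s) N / E (a * q ^ N / s)"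
    using l[of "a / s" "a * q / s"] g(5)[of N] by (simp add: s_def)
  \<comment> \<open>Balancing makes each quotient containing e the reciprocal of one containing s,
    at the price of the prefactor in the reflection formula.\<close>
  have inv: "E (a * q / e) = - (s / y) * E (y / s)" "E (a * q ^ 2 / e) = - (s * q / y) * E (a * q ^ N / s)"
    "E (a * q ^ (N + 2) / e) = - (s / a) * E (a / s)" "E (1 / (q ^ N * e)) = - (s / y ^ 2) * E (y ^ 2 / s)"
  proof -
    have "a * q / e = s / y" "a * q ^ 2 / e = s * q / y" "a * q ^ (N + 2) / e = s / a"
      "1 / (q ^ N * e) = s / y ^ 2" "y / (s * q) = a * q ^ N / s"
      unfolding ey using nz q s by (simp_all add: y_def power2_eq_square)
    then show "E (a * q / e) = - (s / y) * E (y / s)" "E (a * q ^ 2 / e) = - (s * q / y) * E (a * q ^ N / s)"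
      "E (a * q ^ (N + 2) / e) = - (s / a) * E (a / s)" "E (1 / (q ^ N * e)) = - (s / y ^ 2) * E (y ^ 2 / s)"
      using E_swap[of s y] E_swap[of "s * q" y] E_swap[of s a] E_swap[of s "y ^ 2"] s y q nz by simp_all
  qed
  have combine: "(A * l) * (B1 * l1) * (B2 * l2) * (B3 * l3) / ((D1 * m1) * (D2 * m2) * (D3 * m3) * (D4 * m4))
     = A * B1 * B2 * B3 / (D1 * D2 * D3 * D4)
     + E1 * E2 * Eb * Ec * Ed * (a * y * q / s * (- (s / y ^ 2) * M * (- (s / a) * g)))
        / (F1 * F2 * F3 * (- (s / y) * m4) * (- (s * q / y) * h) * l * H2)
       * (A * l * H2 / (E1 * E2) * B1 * B2 * B3
          / ((D1 * m1 / F1) * (D2 * m2 / F2) * (D3 * m3 / F3) * (g * D4 / h)))"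
    if W: "l * l1 * l2 * l3 - m1 * m2 * m3 * m4 = y / s * Eb * Ec * Ed * M"
      and nz': "E1 \<noteq> 0" "E2 \<noteq> 0" "F1 \<noteq> 0" "F2 \<noteq> 0" "F3 \<noteq> 0" "g \<noteq> 0" "h \<noteq> 0" "l \<noteq> 0"
        "H2 \<noteq> 0" "m1 \<noteq> 0" "m2 \<noteq> 0" "m3 \<noteq> 0" "m4 \<noteq> 0"
    for A B1 B2 B3 D1 D2 D3 D4 l l1 l2 l3 m1 m2 m3 m4 E1 E2 Eb Ec Ed M F1 F2 F3 g h H2 :: complex
  proof -
    define R where "R = A * B1 * B2 * B3 / (D1 * D2 * D3 * D4)"
    have "E1 * E2 * Eb * Ec * Ed * (a * y * q / s * (- (s / y ^ 2) * M * (- (s / a) * g)))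
        / (F1 * F2 * F3 * (- (s / y) * m4) * (- (s * q / y) * h) * l * H2)
       * (A * l * H2 / (E1 * E2) * B1 * B2 * B3
          / ((D1 * m1 / F1) * (D2 * m2 / F2) * (D3 * m3 / F3) * (g * D4 / h)))
      = R * (y / s * Eb * Ec * Ed * M / (m1 * m2 * m3 * m4))"
      using nz' nz q s y unfolding R_def by (simp add: power2_eq_square mult_ac)
    moreover have "(A * l) * (B1 * l1) * (B2 * l2) * (B3 * l3) / ((D1 * m1) * (D2 * m2) * (D3 * m3) * (D4 * m4))
      = R * (l * l1 * l2 * l3 / (m1 * m2 * m3 * m4))"
      unfolding R_def by (simp add: mult_ac)
    moreover have "l * l1 * l2 * l3 / (m1 * m2 * m3 * m4) = 1 + y / s * Eb * Ec * Ed * M / (m1 * m2 * m3 * m4)"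
      using nz' unfolding W[symmetric] by (simp add: diff_divide_distrib)
    ultimately show ?thesis unfolding R_def[symmetric] by (simp add: distrib_left)
  qed
  have gy: "E y \<noteq> 0" "E (y / b) \<noteq> 0" "E (y / c) \<noteq> 0" "E (y / d) \<noteq> 0" "E (y / s) \<noteq> 0"
    using g[of "N + 1"] unfolding y_def s_def by simp_all
  have g1: "E (a * q) \<noteq> 0" "E (a * q / b) \<noteq> 0" "E (a * q / c) \<noteq> 0" "E (a * q / d) \<noteq> 0"
    using g[of 1] by simp_all
  have g2: "E (a * q ^ 2) \<noteq> 0" "E (a / s) \<noteq> 0" "E (a * q ^ N / s) \<noteq> 0" "E (a * q ^ (N + 2)) \<noteq> 0"
    using g(1)[of 2] g(5)[of 0] g(5)[of N] g(1)[of "N + 2"] by (simp_all add: s_def)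
  show ?thesis
    unfolding ft_rhs_def ft_shift_coeff_def args s_def[symmetric] P_Suc args' D[OF g1(2)] D[OF g1(3)] D[OF g1(4)]
      A S inv y_def[symmetric]
    unfolding ey
    by (rule combine[OF W]) (use gy g1 g2 in auto)
qed

text \<open>Raising N by one splits each summand with k >= 1 into a summand for N with e / q and a
  multiple of a shifted summand for N at k - 1. The induction hypothesis is applied to both sums, so
  a, b, c, d have to vary in the induction.\<close>

theorem frenkel_turaev:
  assumes "ft_generic a b c d" "P q N \<noteq> 0"
  shows "(\<Sum>k\<le>N. ft_term a b c d (a ^ 2 * q ^ (N + 1) / (b * c * d)) N k) = ft_rhs a b c d N"
  using assms
proof (induction N arbitrary: a b c d)
  case 0
  then show ?case
    using ft_generic_power(1)[OF 0(1), of 0] by (simp add: ft_term_def ft_rhs_def)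
next
  case (Suc N)
  note gen = Suc.prems(1)
  have nz: "a \<noteq> 0" "b \<noteq> 0" "c \<noteq> 0" "d \<noteq> 0" using gen by (auto simp: ft_generic_def)
  note q = q_nz
  define e where "e = a ^ 2 * q ^ (N + 2) / (b * c * d)"
  have e0: "e \<noteq> 0" using nz q by (simp add: e_def)
  have e_gen: "E (a * q ^ i / e) \<noteq> 0" for i
  proof -
    define z where "z = a * q powi (int (N + 2) - int i) / (b * c * d)"
    have "E z \<noteq> 0" "z \<noteq> 0" using gen nz q by (auto simp: ft_generic_def z_def)
    moreover have "a * q ^ i / e = 1 / z"
      unfolding z_def e_def power_int_diff[OF disjI1[OF q]] power_int_of_nat
      using nz q by (simp add: power2_eq_square)
    ultimately show ?thesis by (simp add: E_inverse)
  qed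
  have Pe: "P (a * q ^ 3 / e) j \<noteq> 0" for j
    using e_gen[of "3 + _"] by (auto simp: P_def power_add mult_ac)
  have Pq: "E (q ^ Suc i) \<noteq> 0" if "i \<le> N" for i
    using Suc.prems(2) that unfolding P_def by (auto simp: le_less)
  have Pqj: "P q j \<noteq> 0" if "j \<le> Suc N" for j
    using Suc.prems(2) that P_add[of q j "Suc N - j"] by auto
  have step: "ft_term a b c d e (Suc N) (Suc j) = ft_term a b c d (e / q) N (Suc j)
    + ft_shift_coeff a b c d e N * ft_term (a * q ^ 2) (b * q) (c * q) (d * q) e N j" if "j \<le> N" for j
    using e_gen[of 1] e_gen[of 2] that Pq Pe Pqj[of j] by (intro ft_term_Suc gen e0) auto
  have zero: "ft_term a b c d x M 0 = 1" for x M
    using ft_generic_power(1)[OF gen, of 0] by (simp add: ft_term_def)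
  \<comment> \<open>The factorial of \<open>1 / q ^ N\<close> contains \<open>E 1 = 0\<close>, so
    the sum for N may as well run to N + 1.\<close>
  have last: "ft_term a b c d (e / q) N (Suc N) = 0"
    using q ellE_one[OF norm_p] by (simp add: ft_term_def P_Suc[of "1 / q ^ N"])
  \<comment> \<open>Both sums are balanced for N: e / q belongs to the old parameters, and e to the
    shifted ones because a^2 gains q^4 while b c d gains q^3.\<close>
  have e1: "e / q = a ^ 2 * q ^ (N + 1) / (b * c * d)"
    using q by (simp add: e_def)
  have e2: "e = (a * q ^ 2) ^ 2 * q ^ (N + 1) / (b * q * (c * q) * (d * q))"
    using q by (simp add: e_def power2_eq_square mult_ac)
  have "(\<Sum>k\<le>Suc N. ft_term a b c d e (Suc N) k)
    = 1 + (\<Sum>j\<le>N. ft_term a b c d (e / q) N (Suc j)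
       + ft_shift_coeff a b c d e N * ft_term (a * q ^ 2) (b * q) (c * q) (d * q) e N j)"
    unfolding sum.atMost_Suc_shift zero by (simp add: step)
  also have "\<dots> = (1 + (\<Sum>j\<le>N. ft_term a b c d (e / q) N (Suc j)))
      + ft_shift_coeff a b c d e N * (\<Sum>j\<le>N. ft_term (a * q ^ 2) (b * q) (c * q) (d * q) e N j)"
    by (simp add: sum.distrib sum_distrib_left)
  also have "1 + (\<Sum>j\<le>N. ft_term a b c d (e / q) N (Suc j)) = (\<Sum>k\<le>Suc N. ft_term a b c d (e / q) N k)"
    unfolding sum.atMost_Suc_shift zero ..
  also have "\<dots> = (\<Sum>k\<le>N. ft_term a b c d (e / q) N k)"
    by (simp add: last)
  also have "\<dots> = ft_rhs a b c d N"
    unfolding e1 by (rule Suc.IH[OF gen Pqj]) simp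
  also have "(\<Sum>j\<le>N. ft_term (a * q ^ 2) (b * q) (c * q) (d * q) e N j) = ft_rhs (a * q ^ 2) (b * q) (c * q) (d * q) N"
    unfolding e2 by (rule Suc.IH[OF ft_generic_shift[OF gen] Pqj]) simp
  also have "ft_rhs a b c d N + ft_shift_coeff a b c d e N * ft_rhs (a * q ^ 2) (b * q) (c * q) (d * q) N
    = ft_rhs a b c d (Suc N)"
    by (rule ft_rhs_Suc[OF gen e_def, symmetric])
  finally show ?case by (simp add: e_def)
qed

end

section \<open>The determinant evaluation\<close>

lemma det_mat_sum_permutations:
  "det (mat n n M) = (\<Sum>\<pi> | \<pi> permutes {0..<n}. signof \<pi> * (\<Prod>i = 0..<n. M (i, \<pi> i)))"
proof -
  have "(\<Prod>i = 0..<n. mat n n M $$ (i, \<pi> i)) = (\<Prod>i = 0..<n. M (i, \<pi> i))"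
    if "\<pi> permutes {0..<n}" for \<pi>
    using permutes_in_image[OF that] by (intro prod.cong) auto
  then show ?thesis by (simp add: det_def)
qed

lemma det_scale:
  fixes M :: "nat \<Rightarrow> nat \<Rightarrow> 'a :: comm_ring_1"
  shows "det (mat n n (\<lambda>(i, j). a i * b j * M i j))
    = (\<Prod>i<n. a i) * (\<Prod>j<n. b j) * det (mat n n (\<lambda>(i, j). M i j))"
proof -
  have "signof \<pi> * (\<Prod>i = 0..<n. a i * b (\<pi> i) * M i (\<pi> i))
    = (\<Prod>i<n. a i) * (\<Prod>j<n. b j) * (signof \<pi> * (\<Prod>i = 0..<n. M i (\<pi> i)))"
    if "\<pi> permutes {0..<n}" for \<pi>
    using prod.permute[OF that, of b] by (simp add: prod.distrib lessThan_atLeast0 o_def mult_ac)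
  then show ?thesis by (simp add: det_mat_sum_permutations sum_distrib_left)
qed

text \<open>Row i depends on \<open>k i\<close> alone, so for each permutation in the Leibniz
  formula the sum over all k factors into n single sums.\<close>

lemma sum_det_rows:
  fixes M :: "nat \<Rightarrow> nat \<Rightarrow> 'b \<Rightarrow> 'a :: comm_ring_1"
  assumes "\<And>i. i < n \<Longrightarrow> finite (B i)"
  shows "(\<Sum>k\<in>PiE {..<n} B. det (mat n n (\<lambda>(i, j). M i j (k i))))
    = det (mat n n (\<lambda>(i, j). \<Sum>k\<in>B i. M i j k))"
proof -
  have "(\<Sum>k\<in>PiE {..<n} B. det (mat n n (\<lambda>(i, j). M i j (k i))))
    = (\<Sum>\<pi> | \<pi> permutes {0..<n}. signof \<pi> * (\<Sum>k\<in>PiE {..<n} B. \<Prod>i<n. M i (\<pi> i) (k i)))"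
    unfolding det_mat_sum_permutations by (subst sum.swap) (simp add: sum_distrib_left lessThan_atLeast0)
  also have "\<dots> = (\<Sum>\<pi> | \<pi> permutes {0..<n}. signof \<pi> * (\<Prod>i<n. \<Sum>k\<in>B i. M i (\<pi> i) k))"
    by (subst prod_sum_PiE) (use assms in auto)
  finally show ?thesis
    unfolding det_mat_sum_permutations by (simp add: lessThan_atLeast0)
qed

text \<open>If the \<open>2 \<times> 2\<close> minors factor, then eliminating the last row by adjacent column
  operations reproduces a determinant of the same shape and size \<open>n - 1\<close>.\<close>
lemma det_exchange:
  fixes f h :: "nat \<Rightarrow> nat \<Rightarrow> 'a :: field"
  assumes "\<And>r s i j. i < n \<Longrightarrow> j < n \<Longrightarrow> f r i * h s j - f r j * h s i = \<kappa> r s * W i j"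
    and "\<And>s i. s < n \<Longrightarrow> i < n \<Longrightarrow> h s i \<noteq> 0"
  shows "det (mat n n (\<lambda>(i, j). (\<Prod>r<n - 1 - j. f r i) * (\<Prod>s<j. h s i)))
    = (\<Prod>l<n. \<Prod>s<l. \<kappa> (l - 1 - s) s) * (\<Prod>j<n. \<Prod>i<j. W i j)"
  using assms
proof (induction n)
  case 0
  then show ?case by simp
next
  case (Suc n)
  note ex = Suc.prems(1)
  define F where "F m i = (\<Prod>r<m. f r i)" for m i
  define H where "H m i = (\<Prod>s<m. h s i)" for m i
  define M where "M = mat (Suc n) (Suc n) (\<lambda>(i, j). F (n - j) i * H j i)"
  define M' where "M' = mat n n (\<lambda>(i, j). F (n - 1 - j) i * H j i)"
  \<comment> \<open>Multiplication by L on the right replaces column j < n by \<open>h j n\<close>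
    times itself minus \<open>f (n - 1 - j) n\<close> times column j + 1. Its determinant, the
    product of the \<open>h j n\<close>, has to be cancelled at the end; hence the assumption that h
    does not vanish.\<close>
  define L where "L = mat (Suc n) (Suc n) (\<lambda>(i, j). if i = j then (if j < n then h j n else 1)
      else if i = Suc j then - f (n - 1 - j) n else 0)"
  have IH: "det M' = (\<Prod>l<n. \<Prod>s<l. \<kappa> (l - 1 - s) s) * (\<Prod>j<n. \<Prod>i<j. W i j)"
    unfolding M'_def F_def H_def by (rule Suc.IH) (use Suc.prems in auto)
  have carr: "M \<in> carrier_mat (Suc n) (Suc n)" "L \<in> carrier_mat (Suc n) (Suc n)"
    by (simp_all add: M_def L_def)
  have detL: "det L = H n n"
  proof -
    have "det L = prod_list (diag_mat L)"
      by (rule det_lower_triangular[OF _ carr(2)]) (auto simp: L_def)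
    also have "\<dots> = (\<Prod>i<Suc n. L $$ (i, i))"
      using carr(2) by (simp add: diag_mat_def prod.list_conv_set_nth lessThan_atLeast0 del: upt_Suc prod.op_ivl_Suc prod.lessThan_Suc)
    also have "\<dots> = H n n" by (simp add: L_def H_def)
    finally show ?thesis .
  qed
  have col_op: "(M * L) $$ (i, j) = (if j < n then h j n * M $$ (i, j) - f (n - 1 - j) n * M $$ (i, Suc j) else M $$ (i, j))"
    if ij: "i < Suc n" "j < Suc n" for i j
  proof -
    have "(M * L) $$ (i, j) = (\<Sum>k<Suc n. M $$ (i, k) * L $$ (k, j))"
      using carr ij by (simp add: scalar_prod_def lessThan_atLeast0 del: sum.op_ivl_Suc sum.lessThan_Suc)
    also have "\<dots> = (\<Sum>k\<in>{..<Suc n} \<inter> {j, Suc j}. M $$ (i, k) * L $$ (k, j))"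
      by (rule sum.mono_neutral_right) (use ij in \<open>auto simp: L_def\<close>)
    also have "\<dots> = (if j < n then h j n * M $$ (i, j) - f (n - 1 - j) n * M $$ (i, Suc j) else M $$ (i, j))"
    proof (cases "j < n")
      case True
      then have "{..<Suc n} \<inter> {j, Suc j} = {j, Suc j}" by auto
      then show ?thesis using True by (simp add: L_def)
    next
      case False
      then have "{..<Suc n} \<inter> {j, Suc j} = {j}" "j = n" using ij by auto
      then show ?thesis by (simp add: L_def)
    qed
    finally show ?thesis .
  qed
  have entry: "(M * L) $$ (i, j) = W i n * \<kappa> (n - 1 - j) j * (F (n - 1 - j) i * H j i)"
    if ij: "i < Suc n" "j < n" for i j
  proof -
    have m: "n - j = Suc (n - 1 - j)" "n - Suc j = n - 1 - j" using ij by auto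
    have M1: "M $$ (i, j) = F (n - 1 - j) i * f (n - 1 - j) i * H j i"
    proof -
      have "F (n - j) i = F (n - 1 - j) i * f (n - 1 - j) i"
        unfolding m(1) by (simp only: F_def prod.lessThan_Suc)
      then show ?thesis using ij by (simp add: M_def)
    qed
    have M2: "M $$ (i, Suc j) = F (n - 1 - j) i * (H j i * h j i)"
      using ij by (simp add: M_def H_def)
    have "(M * L) $$ (i, j) = (f (n - 1 - j) i * h j n - f (n - 1 - j) n * h j i) * (F (n - 1 - j) i * H j i)"
      using col_op[of i j] ij unfolding M1 M2 by (simp add: algebra_simps)
    then show ?thesis using ex[of i n "n - 1 - j" j] ij by (simp add: mult_ac)
  qed
  have last_entry: "(M * L) $$ (n, j) = 0" if "j < n" for j
  proof -
    \<comment> \<open>For i = j the two products in the exchange relation coincide; this clears the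
      last row of \<open>M * L\<close> off the diagonal.\<close>
    have "\<kappa> (n - 1 - j) j * W n n = 0" using ex[of n n "n - 1 - j" j] by simp
    then show ?thesis using entry[of n j] that by auto
  qed
  have corner: "(M * L) $$ (n, n) = H n n"
    using col_op[of n n] by (simp add: M_def F_def)
  have "det (M * L) = (\<Sum>j<Suc n. (M * L) $$ (n, j) * cofactor (M * L) n j)"
    by (rule laplace_expansion_row) (use carr in auto)
  also have "\<dots> = H n n * cofactor (M * L) n n"
    using last_entry corner by simp
  also have "cofactor (M * L) n n = det (mat_delete (M * L) n n)"
    by (simp add: cofactor_def)
  also have "mat_delete (M * L) n n = mat n n (\<lambda>(i, j). W i n * \<kappa> (n - 1 - j) j * (F (n - 1 - j) i * H j i))"
    by (rule eq_matI) (use carr entry in \<open>auto simp: mat_delete_def\<close>)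
  also have "det \<dots> = (\<Prod>i<n. W i n) * (\<Prod>j<n. \<kappa> (n - 1 - j) j) * det M'"
    unfolding M'_def by (rule det_scale)
  finally have "det M * H n n = H n n * ((\<Prod>i<n. W i n) * (\<Prod>j<n. \<kappa> (n - 1 - j) j) * det M')"
    using det_mult[OF carr] detL by simp
  moreover have "H n n \<noteq> 0" using Suc.prems(2) by (simp add: H_def)
  ultimately have "det M = (\<Prod>i<n. W i n) * (\<Prod>j<n. \<kappa> (n - 1 - j) j) * det M'"
    by (simp add: mult.commute)
  then show ?case unfolding IH M_def F_def H_def by (simp add: mult_ac)
qed

context elliptic_nome
begin

section \<open>The theta determinant and the sums in its rows\<close>

definition R :: "complex \<Rightarrow> nat \<Rightarrow> complex" where
  "R y m = (\<Prod>r<m. E (y / q ^ r))"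

lemma R_eq_P: "R y m = P (y * q / q ^ m) m"
proof -
  have "R y m = (\<Prod>i<m. E (y / q ^ (m - Suc i)))"
    unfolding R_def by (rule prod.nat_diff_reindex[symmetric])
  also have "\<dots> = P (y * q / q ^ m) m"
    unfolding P_def
  proof (rule prod.cong)
    fix i assume "i \<in> {..<m}"
    then have "q ^ m = q ^ (m - Suc i) * q * q ^ i"
      by (metis lessThan_iff add_Suc_right le_add_diff_inverse2 less_imp_Suc_add mult.assoc power_Suc power_add Suc_leI power_commutes)
    then show "E (y / q ^ (m - Suc i)) = E (y * q / q ^ m * q ^ i)" using q_nz by simp
  qed simp
  finally show ?thesis .
qed

text \<open>Both sides are the factorial of length m + k starting at \<open>y q / q^m\<close>, split
  in two ways. A shift of the argument by q^k is thereby traded for a change of parameter in a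
  factorial of length k.\<close>

lemma R_shift: "R y m * P (y * q) k = P (y * q / q ^ m) k * R (y * q ^ k) m"
proof -
  have "P (y * q / q ^ m) m * P (y * q / q ^ m * q ^ m) k = P (y * q / q ^ m) k * P (y * q / q ^ m * q ^ k) m"
    by (metis P_add add.commute)
  moreover have "y * q / q ^ m * q ^ m = y * q" "y * q / q ^ m * q ^ k = y * q ^ k * q / q ^ m"
    using q_nz by simp_all
  ultimately show ?thesis unfolding R_eq_P by (simp only:)
qed

definition entry :: "complex \<Rightarrow> complex \<Rightarrow> complex \<Rightarrow> nat \<Rightarrow> nat \<Rightarrow> complex \<Rightarrow> complex" where
  "entry a b c m j X = P (b * X) m * R (a * X / b) m * (P (c * X) j * R (a * X / c) j)"

definition det_const :: "complex \<Rightarrow> complex \<Rightarrow> complex \<Rightarrow> nat \<Rightarrow> complex" where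
  "det_const a b c n = (\<Prod>l<n. \<Prod>s<l. b * q ^ (l - 1 - s) * E (c * q ^ s / (b * q ^ (l - 1 - s))) * E (a / (b * c * q ^ (l - 1))))"

text \<open>The addition formula with u = b q^r and v = c q^s is the exchange relation that the
  general evaluation requires.\<close>

lemma det_entry:
  assumes nz: "a \<noteq> 0" "b \<noteq> 0" "c \<noteq> 0" and X: "\<And>i. i < n \<Longrightarrow> X i \<noteq> 0"
    and gen: "\<And>s i. s < n \<Longrightarrow> i < n \<Longrightarrow> E (c * X i * q ^ s) \<noteq> 0 \<and> E (a * X i / c / q ^ s) \<noteq> 0"
  shows "det (mat n n (\<lambda>(i, j). entry a b c (n - 1 - j) j (X i)))
    = det_const a b c n * (\<Prod>i<n. X i ^ i) * (\<Prod>j<n. \<Prod>i<j. E (X i / X j) * E (a * X i * X j))"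
proof -
  note q = q_nz
  define f where "f r i = E (b * q ^ r * X i) * E (a * X i / (b * q ^ r)) / X i" for r i
  define h where "h s i = E (c * q ^ s * X i) * E (a * X i / (c * q ^ s)) / X i" for s i
  define \<kappa> where "\<kappa> r s = b * q ^ r * E (c * q ^ s / (b * q ^ r)) * E (a / (b * c * q ^ (r + s)))" for r s
  define W where "W i j = E (X i / X j) * E (a * X i * X j) / X i" for i j
  have ex: "f r i * h s j - f r j * h s i = \<kappa> r s * W i j" if "i < n" "j < n" for r s i j
  proof -
    have "f r i * h s j - f r j * h s i
      = (E (b * q ^ r * X i) * E (a * X i / (b * q ^ r)) * (E (c * q ^ s * X j) * E (a * X j / (c * q ^ s)))
       - E (b * q ^ r * X j) * E (a * X j / (b * q ^ r)) * (E (c * q ^ s * X i) * E (a * X i / (c * q ^ s)))) / (X i * X j)"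
      unfolding f_def h_def by (simp add: diff_divide_distrib mult_ac)
    also have "\<dots> = b * q ^ r * X j * E (c * q ^ s / (b * q ^ r)) * E (a / (b * q ^ r * (c * q ^ s)))
       * E (X i / X j) * E (a * X i * X j) / (X i * X j)"
      by (subst E_addition) (use nz q X that in auto)
    also have "b * q ^ r * (c * q ^ s) = b * c * q ^ (r + s)" by (simp add: power_add)
    finally show ?thesis using X[OF that(2)] unfolding \<kappa>_def W_def by simp
  qed
  have h0: "h s i \<noteq> 0" if "s < n" "i < n" for s i
    using gen[OF that] X[OF that(2)] by (simp add: h_def mult_ac)
  have fp: "(\<Prod>r<m. f r i) = P (b * X i) m * R (a * X i / b) m / X i ^ m" for m i
    by (simp add: f_def P_def R_def prod_dividef prod.distrib mult_ac)
  have hp: "(\<Prod>s<m. h s i) = P (c * X i) m * R (a * X i / c) m / X i ^ m" for m i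
    by (simp add: h_def P_def R_def prod_dividef prod.distrib mult_ac)
  have ent: "entry a b c (n - 1 - j) j (X i) = X i ^ (n - 1) * 1 * ((\<Prod>r<n - 1 - j. f r i) * (\<Prod>s<j. h s i))"
    if "i < n" "j < n" for i j
  proof -
    have "X i ^ (n - 1) = X i ^ (n - 1 - j) * X i ^ j" using that by (simp flip: power_add)
    then show ?thesis using X[OF that(1)] unfolding entry_def fp hp by simp
  qed
  have "mat n n (\<lambda>(i, j). entry a b c (n - 1 - j) j (X i))
    = mat n n (\<lambda>(i, j). X i ^ (n - 1) * 1 * ((\<Prod>r<n - 1 - j. f r i) * (\<Prod>s<j. h s i)))"
    by (rule cong_mat) (simp_all only: ent prod.case)
  then have "det (mat n n (\<lambda>(i, j). entry a b c (n - 1 - j) j (X i)))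
    = (\<Prod>i<n. X i ^ (n - 1)) * (\<Prod>j<n. 1) * det (mat n n (\<lambda>(i, j). (\<Prod>r<n - 1 - j. f r i) * (\<Prod>s<j. h s i)))"
    by (simp only: det_scale)
  also have "det (mat n n (\<lambda>(i, j). (\<Prod>r<n - 1 - j. f r i) * (\<Prod>s<j. h s i)))
    = (\<Prod>l<n. \<Prod>s<l. \<kappa> (l - 1 - s) s) * (\<Prod>j<n. \<Prod>i<j. W i j)"
    by (rule det_exchange) (use ex h0 in auto)
  also have "(\<Prod>l<n. \<Prod>s<l. \<kappa> (l - 1 - s) s) = det_const a b c n"
    unfolding det_const_def \<kappa>_def by (intro prod.cong refl) auto
  also have "(\<Prod>j<n. \<Prod>i<j. W i j) = (\<Prod>j<n. \<Prod>i<j. E (X i / X j) * E (a * X i * X j)) / (\<Prod>j<n. \<Prod>i<j. X i)"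
    by (simp add: W_def prod_dividef)
  finally have D: "det (mat n n (\<lambda>(i, j). entry a b c (n - 1 - j) j (X i)))
    = (\<Prod>i<n. X i ^ (n - 1)) * (det_const a b c n
      * ((\<Prod>j<n. \<Prod>i<j. E (X i / X j) * E (a * X i * X j)) / (\<Prod>j<n. \<Prod>i<j. X i)))" by simp
  \<comment> \<open>Row i carries the factor \<open>X i ^ (n - 1)\<close>, and the factors
    \<open>W i j\<close> with j > i contain \<open>1 / X i\<close> altogether n - 1 - i times. The
    remaining \<open>X i ^ i\<close> is the source of the weight \<open>q^(i k_i)\<close>.\<close>
  have pw: "(\<Prod>i<m. X i ^ (m - 1)) = (\<Prod>i<m. X i ^ i) * (\<Prod>j<m. \<Prod>i<j. X i)" for m
  proof (induction m)
    case (Suc m)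
    have "(\<Prod>i<m. X i ^ m) = (\<Prod>i<m. X i ^ (m - 1)) * (\<Prod>i<m. X i)"
    proof (cases m)
      case (Suc l)
      then show ?thesis by (simp add: power_Suc2 prod.distrib del: power_Suc prod.lessThan_Suc)
    qed simp
    then show ?case using Suc by (simp add: mult_ac)
  qed simp
  have "(\<Prod>j<n. \<Prod>i<j. X i) \<noteq> 0" using X by auto
  then show ?thesis unfolding D pw by simp
qed

text \<open>The factors of the entry at \<open>x q^k\<close> are absorbed into the factorials of
  length k. After the summation the same exchange, now with k = N, runs backwards: it restores the
  denominators in b and c and leaves the entry with a replaced by \<open>a q^N\<close>.\<close>

lemma row_sum:
  assumes gen: "ft_generic (a * x ^ 2) (b * q ^ m * x) (c * q ^ j * x) (d * x)"
    and nz: "a \<noteq> 0" "b \<noteq> 0" "c \<noteq> 0" "d \<noteq> 0" "x \<noteq> 0"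
    and bal: "e = a ^ 2 * q ^ (N + 1) / (b * c * d * q ^ (m + j))"
    and Pq: "P q N \<noteq> 0"
    and gen_b: "\<And>k. k \<le> N \<Longrightarrow> P (a * x * q / b) k \<noteq> 0" and gen_c: "\<And>k. k \<le> N \<Longrightarrow> P (a * x * q / c) k \<noteq> 0"
  shows "(\<Sum>k\<le>N. ft_term (a * x ^ 2) (b * x) (c * x) (d * x) (e * x) N k * entry a b c m j (x * q ^ k))
    = P (a * q * x ^ 2) N * P (a * q / (b * c * q ^ (m + j))) N
       / (P (a * x * q / b) N * P (a * x * q / c) N * P (a * x * q / d) N * P (a * q / (b * c * d * x * q ^ (m + j))) N)
     * (P (a * q / (b * d * q ^ m)) N * P (a * q / (c * d * q ^ j)) N)
     * entry (a * q ^ N) b c m j x"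
proof -
  note q = q_nz
  have Pz: "P (a * x * q / (b * q ^ m)) k \<noteq> 0" "P (a * x * q / (c * q ^ j)) k \<noteq> 0" for k
  proof -
    have "a * x ^ 2 * q powi 1 * q ^ i / (b * q ^ m * x) = a * x * q / (b * q ^ m) * q ^ i"
      "a * x ^ 2 * q powi 1 * q ^ i / (c * q ^ j * x) = a * x * q / (c * q ^ j) * q ^ i" for i
      using nz by (simp_all add: power2_eq_square)
    then have "E (a * x * q / (b * q ^ m) * q ^ i) \<noteq> 0" "E (a * x * q / (c * q ^ j) * q ^ i) \<noteq> 0" for i
      using ft_generic_power[OF gen, of "Suc i"] by (simp_all add: mult_ac)
    then show "P (a * x * q / (b * q ^ m)) k \<noteq> 0" "P (a * x * q / (c * q ^ j)) k \<noteq> 0"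
      by (simp_all add: P_def)
  qed
  have shb: "P (b * x) k * P (b * x * q ^ k) m = P (b * x) m * P (b * q ^ m * x) k" for b m k
    using P_add[of "b * x" k m] P_add[of "b * x" m k] by (simp add: add.commute mult_ac)
  have shR: "R (a * x / b * q ^ k) m / P (a * x * q / b) k = R (a * x / b) m / P (a * x * q / (b * q ^ m)) k"
    if "P (a * x * q / b) k \<noteq> 0" "P (a * x * q / (b * q ^ m)) k \<noteq> 0" for b m k
    using R_shift[of "a * x / b" m k] that by (simp add: field_simps)
  have args: "a * x ^ 2 * q / (b * x) = a * x * q / b" if "b \<noteq> 0" for b
    using that nz by (simp add: power2_eq_square)
  have qnz: "q ^ i \<noteq> 0" for i using q by simp
  have term_eq: "ft_term (a * x ^ 2) (b * x) (c * x) (d * x) (e * x) N k * entry a b c m j (x * q ^ k)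
    = entry a b c m j x * ft_term (a * x ^ 2) (b * q ^ m * x) (c * q ^ j * x) (d * x) (e * x) N k"
    if "k \<le> N" for k
  proof -
    define Z where "Z = E (a * x ^ 2 * q ^ (2 * k)) / E (a * x ^ 2)
     * (P (a * x ^ 2) k * P (d * x) k * P (e * x) k * P (1 / q ^ N) k * q ^ k)
     / (P q k * P (a * x ^ 2 * q / (d * x)) k * P (a * x ^ 2 * q / (e * x)) k
        * P (a * x ^ 2 * q ^ (N + 1)) k)"
    have "ft_term (a * x ^ 2) (b * x) (c * x) (d * x) (e * x) N k * entry a b c m j (x * q ^ k)
      = Z * (P (b * x) k * P (b * x * q ^ k) m) * (P (c * x) k * P (c * x * q ^ k) j)
        * (R (a * x / b * q ^ k) m / P (a * x * q / b) k) * (R (a * x / c * q ^ k) j / P (a * x * q / c) k)"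
      unfolding ft_term_def entry_def Z_def args[OF nz(2)] args[OF nz(3)]
      by (simp add: mult_ac)
    also have "\<dots> = Z * (P (b * x) m * P (b * q ^ m * x) k) * (P (c * x) j * P (c * q ^ j * x) k)
        * (R (a * x / b) m / P (a * x * q / (b * q ^ m)) k) * (R (a * x / c) j / P (a * x * q / (c * q ^ j)) k)"
      unfolding shb using shR[OF gen_b[OF that] Pz(1)] shR[OF gen_c[OF that] Pz(2)] by (simp only:)
    also have "\<dots> = entry a b c m j x * ft_term (a * x ^ 2) (b * q ^ m * x) (c * q ^ j * x) (d * x) (e * x) N k"
      using args[of "b * q ^ m"] args[of "c * q ^ j"] nz q
      unfolding ft_term_def entry_def Z_def by (simp add: mult_ac)
    finally show ?thesis .
  qed
  have ex: "e * x = (a * x ^ 2) ^ 2 * q ^ (N + 1) / (b * q ^ m * x * (c * q ^ j * x) * (d * x))"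
    unfolding bal using nz q by (simp add: power2_eq_square power_add mult_ac)
  have "(\<Sum>k\<le>N. ft_term (a * x ^ 2) (b * x) (c * x) (d * x) (e * x) N k * entry a b c m j (x * q ^ k))
    = entry a b c m j x * (\<Sum>k\<le>N. ft_term (a * x ^ 2) (b * q ^ m * x) (c * q ^ j * x) (d * x) (e * x) N k)"
    by (simp add: term_eq sum_distrib_left)
  also have "(\<Sum>k\<le>N. ft_term (a * x ^ 2) (b * q ^ m * x) (c * q ^ j * x) (d * x) (e * x) N k)
    = ft_rhs (a * x ^ 2) (b * q ^ m * x) (c * q ^ j * x) (d * x) N"
    unfolding ex by (rule frenkel_turaev[OF gen Pq])
  also have "\<dots> = P (a * q * x ^ 2) N * P (a * q / (b * c * q ^ (m + j))) N
       / (P (a * x * q / d) N * P (a * q / (b * c * d * x * q ^ (m + j))) N)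
     * (P (a * q / (b * d * q ^ m)) N * P (a * q / (c * d * q ^ j)) N)
     / (P (a * x * q / (b * q ^ m)) N * P (a * x * q / (c * q ^ j)) N)"
  proof -
    have "a * x ^ 2 * q = a * q * x ^ 2" "a * x ^ 2 * q / (b * q ^ m * x * (c * q ^ j * x)) = a * q / (b * c * q ^ (m + j))"
     "a * x ^ 2 * q / (b * q ^ m * x * (d * x)) = a * q / (b * d * q ^ m)"
     "a * x ^ 2 * q / (c * q ^ j * x * (d * x)) = a * q / (c * d * q ^ j)"
     "a * x ^ 2 * q / (b * q ^ m * x) = a * x * q / (b * q ^ m)" "a * x ^ 2 * q / (c * q ^ j * x) = a * x * q / (c * q ^ j)"
     "a * x ^ 2 * q / (d * x) = a * x * q / d"
     "a * x ^ 2 * q / (b * q ^ m * x * (c * q ^ j * x) * (d * x)) = a * q / (b * c * d * x * q ^ (m + j))"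
      using nz q by (simp_all add: power2_eq_square power_add mult_ac)
    note A = this
    have "P (a * x ^ 2 * q) N = P (a * q * x ^ 2) N" by (simp only: mult_ac)
    then show ?thesis unfolding ft_rhs_def A(2-) by (simp add: mult_ac)
  qed
  also have "entry a b c m j x * (P (a * q * x ^ 2) N * P (a * q / (b * c * q ^ (m + j))) N
       / (P (a * x * q / d) N * P (a * q / (b * c * d * x * q ^ (m + j))) N)
     * (P (a * q / (b * d * q ^ m)) N * P (a * q / (c * d * q ^ j)) N)
     / (P (a * x * q / (b * q ^ m)) N * P (a * x * q / (c * q ^ j)) N))
    = P (a * q * x ^ 2) N * P (a * q / (b * c * q ^ (m + j))) N
       / (P (a * x * q / d) N * P (a * q / (b * c * d * x * q ^ (m + j))) N)
     * (P (a * q / (b * d * q ^ m)) N * P (a * q / (c * d * q ^ j)) N)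
     * (P (b * x) m * P (c * x) j * (R (a * x / b) m / P (a * x * q / (b * q ^ m)) N)
       * (R (a * x / c) j / P (a * x * q / (c * q ^ j)) N))"
    unfolding entry_def by (simp add: mult_ac)
  also have "R (a * x / b) m / P (a * x * q / (b * q ^ m)) N = R (a * q ^ N * x / b) m / P (a * x * q / b) N"
    using shR[OF gen_b Pz(1), of N] by (simp add: mult_ac)
  also have "R (a * x / c) j / P (a * x * q / (c * q ^ j)) N = R (a * q ^ N * x / c) j / P (a * x * q / c) N"
    using shR[OF gen_c Pz(2), of N] by (simp add: mult_ac)
  finally show ?thesis unfolding entry_def by (simp add: mult_ac)
qed

end

section \<open>The multiple sum for generic parameters\<close>

context elliptic_nome
begin

definition nonvanishing :: "complex \<Rightarrow> bool" where
  "nonvanishing w \<longleftrightarrow> (\<forall>j::int. E (w * q powi j) \<noteq> 0)"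

lemma nonvanishingD: "nonvanishing w \<Longrightarrow> z = w * q powi j \<Longrightarrow> E z \<noteq> 0"
  by (simp add: nonvanishing_def)

lemma nonvanishing_power: "nonvanishing w \<Longrightarrow> z = w * q ^ i \<Longrightarrow> E z \<noteq> 0"
  using nonvanishingD[of w z "int i"] by simp

lemma P_nonvanishing:
  assumes "nonvanishing w" "z = w * q powi j"
  shows "P z k \<noteq> 0"
proof -
  have "E (z * q ^ i) \<noteq> 0" for i
    by (rule nonvanishingD[OF assms(1), of _ "j + int i"]) (use q_nz in \<open>simp add: assms(2) power_int_add\<close>)
  then show ?thesis by (simp add: P_def)
qed

lemma det_const_Suc_Suc:
  "det_const a b c (Suc (Suc m)) = det_const a b c (Suc m)
     * ((\<Prod>s<Suc m. b * q ^ (m - s) * E (c * q ^ s / (b * q ^ (m - s)))) * E (a / (b * c * q ^ m)) ^ Suc m)"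
  unfolding det_const_def prod.lessThan_Suc[of _ "Suc m"]
  by (simp add: prod.distrib del: prod.lessThan_Suc power_Suc)

text \<open>\<open>det_const\<close> depends on a through the theta functions at
  \<open>a / (b c q^(l-1))\<close>, each to the power l. Replacing a by \<open>a q^N\<close> trades
  them for ratios of neighbouring factorials, so the equal factors contributed by the rows turn into
  one factor for each i.\<close>

lemma det_const_shift:
  assumes nz: "b \<noteq> 0" "c \<noteq> 0"
  shows "P (a * q / (b * c * q ^ m)) N ^ Suc m * det_const (a * q ^ N) b c (Suc m)
    = (\<Prod>i<Suc m. P (a * q / (b * c * q ^ i)) N) * det_const a b c (Suc m)"
proof (induction m)
  case 0
  then show ?case by (simp add: det_const_def)
next
  case (Suc m)
  define y where "y = a / (b * c * q ^ m)"
  define C where "C = (\<Prod>s<Suc m. b * q ^ (m - s) * E (c * q ^ s / (b * q ^ (m - s))))"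
  have args: "a * q / (b * c * q ^ Suc m) = y" "a * q / (b * c * q ^ m) = y * q" "a * q ^ N / (b * c * q ^ m) = y * q ^ N"
    using q_nz by (simp_all add: y_def)
  have sh: "P y N * E (y * q ^ N) = E y * P (y * q) N"
    using P_Suc[of y N] P_Suc_left[of y N] by simp
  have IH: "P (y * q) N ^ Suc m * det_const (a * q ^ N) b c (Suc m)
    = (\<Prod>i<Suc m. P (a * q / (b * c * q ^ i)) N) * det_const a b c (Suc m)"
    using Suc unfolding args .
  have "P y N ^ Suc (Suc m) * det_const (a * q ^ N) b c (Suc (Suc m))
    = P y N * C * (P y N * E (y * q ^ N)) ^ Suc m * det_const (a * q ^ N) b c (Suc m)"
    unfolding det_const_Suc_Suc args C_def[symmetric] power_mult_distrib power_Suc[of _ "Suc m"] by (simp only: mult_ac)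
  also have "\<dots> = P y N * C * E y ^ Suc m * (P (y * q) N ^ Suc m * det_const (a * q ^ N) b c (Suc m))"
    unfolding sh power_mult_distrib by (simp only: mult_ac)
  also have "\<dots> = (\<Prod>i<Suc (Suc m). P (a * q / (b * c * q ^ i)) N) * det_const a b c (Suc (Suc m))"
    unfolding IH det_const_Suc_Suc C_def[symmetric] y_def[symmetric] prod.lessThan_Suc[of _ "Suc m"] args
    by (simp only: mult_ac)
  finally show ?case unfolding args .
qed

definition pair_factor :: "complex \<Rightarrow> (nat \<Rightarrow> complex) \<Rightarrow> nat \<Rightarrow> complex" where
  "pair_factor a X n = (\<Prod>j<n. \<Prod>i<j. E (X i / X j) * E (a * X i * X j))"

text \<open>Indices start at 0 and \<open>ft_term\<close> already contains one
  \<open>q ^ k i\<close>; hence the weight \<open>q ^ (i * k i)\<close>.\<close>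

definition lhs_sum where
  "lhs_sum a b c d e x n N = (\<Sum>k\<in>PiE {..<n} (\<lambda>_. {..N}).
     pair_factor a (\<lambda>i. x i * q ^ k i) n / pair_factor (a * q ^ N) x n
     * (\<Prod>i<n. ft_term (a * x i ^ 2) (b * x i) (c * x i) (d * x i) (e * x i) N (k i) * q ^ (i * k i)))"

definition rhs_prod where
  "rhs_prod a b c d x n N = (\<Prod>i<n. P (a * q * x i ^ 2) N * P (a * q / (b * c * q ^ i)) N
      * P (a * q / (b * d * q ^ i)) N * P (a * q / (c * d * q ^ i)) N
     / (P (a * q / (b * c * d * x i * q ^ (n - 1))) N * P (a * x i * q / b) N
       * P (a * x i * q / c) N * P (a * x i * q / d) N))"

text \<open>\<open>c / b\<close> and \<open>a / (b * c)\<close> keep \<open>det_const\<close>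
  nonzero, \<open>c * x i\<close> and \<open>a * x i / c\<close> justify the column elimination, and
  the others serve the Frenkel--Turaev sums and the pair denominators.\<close>

definition generic_params :: "complex \<Rightarrow> complex \<Rightarrow> complex \<Rightarrow> complex \<Rightarrow> (nat \<Rightarrow> complex) \<Rightarrow> nat \<Rightarrow> bool" where
  "generic_params a b c d x n \<longleftrightarrow> nonvanishing (c / b) \<and> nonvanishing (a / (b * c)) \<and>
     (\<forall>i<n. nonvanishing (c * x i) \<and> nonvanishing (a * x i / b) \<and> nonvanishing (a * x i / c)
        \<and> nonvanishing (a * x i / d) \<and> nonvanishing (a / (b * c * d * x i))
        \<and> (\<forall>j<n. nonvanishing (a * x i * x j)))"

lemma lhs_sum_eq_rhs_prod_generic:
  assumes gen: "generic_params a b c d x n"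
    and n: "n > 0"
    and nz: "a \<noteq> 0" "b \<noteq> 0" "c \<noteq> 0" "d \<noteq> 0" and x: "\<And>i. i < n \<Longrightarrow> x i \<noteq> 0"
    and xx: "\<And>i j. i < j \<Longrightarrow> j < n \<Longrightarrow> E (x i / x j) \<noteq> 0"
    and Pq: "P q N \<noteq> 0"
    and bal: "e = a ^ 2 * q ^ (N + 1) / (b * c * d * q ^ (n - 1))"
  shows "lhs_sum a b c d e x n N = rhs_prod a b c d x n N"
proof -
  note q = q_nz
  have gb: "nonvanishing (c / b)" "nonvanishing (a / (b * c))" using gen by (auto simp: generic_params_def)
  have g: "nonvanishing (c * x i)" "nonvanishing (a * x i / b)" "nonvanishing (a * x i / c)"
     "nonvanishing (a * x i / d)" "nonvanishing (a / (b * c * d * x i))" if "i < n" for i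
    using gen that by (auto simp: generic_params_def)
  have gx: "nonvanishing (a * x i * x j)" if "i < n" "j < n" for i j
    using gen that by (auto simp: generic_params_def)
  define w where "w i k = ft_term (a * x i ^ 2) (b * x i) (c * x i) (d * x i) (e * x i) N k" for i k
  define \<rho> where "\<rho> i = P (a * q * x i ^ 2) N * P (a * q / (b * c * q ^ (n - 1))) N
       / (P (a * x i * q / b) N * P (a * x i * q / c) N * P (a * x i * q / d) N * P (a * q / (b * c * d * x i * q ^ (n - 1))) N)" for i
  define \<sigma> where "\<sigma> j = P (a * q / (b * d * q ^ (n - 1 - j))) N * P (a * q / (c * d * q ^ j)) N" for j
  have row: "(\<Sum>k\<le>N. w i k * entry a b c (n - 1 - j) j (x i * q ^ k)) = \<rho> i * \<sigma> j * entry (a * q ^ N) b c (n - 1 - j) j (x i)"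
    if ij: "i < n" "j < n" for i j
  proof -
    define m where "m = n - 1 - j"
    have m: "n - 1 = m + j" using ij by (simp add: m_def)
    have "ft_generic (a * x i ^ 2) (b * q ^ m * x i) (c * q ^ j * x i) (d * x i)"
      unfolding ft_generic_def
    proof (intro conjI allI)
      fix l :: int
      show "E (a * (x i)\<^sup>2 * q powi l) \<noteq> 0"
        by (rule nonvanishingD[OF gx[OF ij(1) ij(1)], of _ l]) (simp add: power2_eq_square)
      show "E (a * (x i)\<^sup>2 * q powi l / (b * q ^ m * x i)) \<noteq> 0"
        by (rule nonvanishingD[OF g(2)[OF ij(1)], of _ "l - int m"])
           (use q x[OF ij(1)] in \<open>simp add: power2_eq_square power_int_diff\<close>)
      show "E (a * (x i)\<^sup>2 * q powi l / (c * q ^ j * x i)) \<noteq> 0"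
        by (rule nonvanishingD[OF g(3)[OF ij(1)], of _ "l - int j"])
           (use q x[OF ij(1)] in \<open>simp add: power2_eq_square power_int_diff\<close>)
      show "E (a * (x i)\<^sup>2 * q powi l / (d * x i)) \<noteq> 0"
        by (rule nonvanishingD[OF g(4)[OF ij(1)], of _ l])
           (use q x[OF ij(1)] in \<open>simp add: power2_eq_square\<close>)
      show "E (a * (x i)\<^sup>2 * q powi l / (b * q ^ m * x i * (c * q ^ j * x i) * (d * x i))) \<noteq> 0"
        by (rule nonvanishingD[OF g(5)[OF ij(1)], of _ "l - int m - int j"])
           (use q x[OF ij(1)] in \<open>simp add: power2_eq_square power_int_diff mult_ac\<close>)
    qed (use nz x[OF ij(1)] q in auto)
    moreover have "P (a * x i * q / b) k \<noteq> 0" for k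
      by (rule P_nonvanishing[OF g(2)[OF ij(1)], of _ 1]) simp
    moreover have "P (a * x i * q / c) k \<noteq> 0" for k
      by (rule P_nonvanishing[OF g(3)[OF ij(1)], of _ 1]) simp
    ultimately show ?thesis
      using row_sum[of a "x i" b m c j d e N] nz x[OF ij(1)] Pq bal
      unfolding w_def \<rho>_def \<sigma>_def m add_diff_cancel_right' by blast
  qed
  \<comment> \<open>The evaluation is needed twice: with M = 0 at the points
    \<open>x i * q ^ k i\<close>, and with M = N at the points \<open>x i\<close>.\<close>
  have det_X: "det (mat n n (\<lambda>(i, j). entry a' b c (n - 1 - j) j (x i * q ^ k i)))
     = det_const a' b c n * (\<Prod>i<n. (x i * q ^ k i) ^ i) * pair_factor a' (\<lambda>i. x i * q ^ k i) n"
    if a': "a' = a * q ^ M" for a' M k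
    unfolding pair_factor_def
  proof (rule det_entry)
    fix s i assume i: "i < n"
    have "E (c * (x i * q ^ k i) * q ^ s) \<noteq> 0"
      by (rule nonvanishing_power[OF g(1)[OF i], of _ "k i + s"]) (simp add: power_add)
    moreover have "E (a' * (x i * q ^ k i) / c / q ^ s) \<noteq> 0"
      by (rule nonvanishingD[OF g(3)[OF i], of _ "int M + int (k i) - int s"])
         (use q in \<open>simp add: a' power_int_add power_int_diff\<close>)
    ultimately show "E (c * (x i * q ^ k i) * q ^ s) \<noteq> 0 \<and> E (a' * (x i * q ^ k i) / c / q ^ s) \<noteq> 0" by blast
  qed (use nz q x a' in auto)
  have K0: "det_const a b c n \<noteq> 0"
  proof -
    have "E (c * q ^ s / (b * q ^ r)) \<noteq> 0" for r s
      by (rule nonvanishingD[OF gb(1), of _ "int s - int r"]) (use q in \<open>simp add: power_int_diff\<close>)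
    moreover have "E (a / (b * c * q ^ r)) \<noteq> 0" for r
      by (rule nonvanishingD[OF gb(2), of _ "- int r"]) (use q in \<open>simp add: power_int_minus divide_inverse\<close>)
    ultimately show ?thesis using nz q by (simp add: det_const_def)
  qed
  define K where "K = det_const a b c n * (\<Prod>i<n. x i ^ i)"
  have K: "K \<noteq> 0" using K0 x by (simp add: K_def)
  have F0: "pair_factor (a * q ^ N) x n \<noteq> 0"
  proof -
    have "E (a * q ^ N * x i * x j) \<noteq> 0" if "i < n" "j < n" for i j
      by (rule nonvanishing_power[OF gx[OF that], of _ N]) simp
    then show ?thesis using xx by (simp add: pair_factor_def)
  qed
  \<comment> \<open>The sum without its pair denominators, which do not depend on k; they come out
    of the second determinant as \<open>pair_factor (a * q ^ N) x n\<close>.\<close>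
  define A where "A = (\<Sum>k\<in>PiE {..<n} (\<lambda>_. {..N}).
     pair_factor a (\<lambda>i. x i * q ^ k i) n * (\<Prod>i<n. w i (k i) * q ^ (i * k i)))"
  have "A * K = (\<Sum>k\<in>PiE {..<n} (\<lambda>_. {..N}). det (mat n n (\<lambda>(i, j). w i (k i) * entry a b c (n - 1 - j) j (x i * q ^ k i))))"
    unfolding A_def sum_distrib_right
  proof (rule sum.cong[OF refl])
    fix k
    have "det (mat n n (\<lambda>(i, j). w i (k i) * entry a b c (n - 1 - j) j (x i * q ^ k i)))
      = (\<Prod>i<n. w i (k i)) * det (mat n n (\<lambda>(i, j). entry a b c (n - 1 - j) j (x i * q ^ k i)))"
      using det_scale[of n "\<lambda>i. w i (k i)" "\<lambda>_. 1"] by simp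
    also have "det (mat n n (\<lambda>(i, j). entry a b c (n - 1 - j) j (x i * q ^ k i)))
      = K * (\<Prod>i<n. q ^ (i * k i)) * pair_factor a (\<lambda>i. x i * q ^ k i) n"
      using det_X[of a 0 k]
      by (simp add: K_def power_mult_distrib prod.distrib mult_ac flip: power_mult)
    finally show "pair_factor a (\<lambda>i. x i * q ^ k i) n * (\<Prod>i<n. w i (k i) * q ^ (i * k i)) * K
      = det (mat n n (\<lambda>(i, j). w i (k i) * entry a b c (n - 1 - j) j (x i * q ^ k i)))"
      by (simp add: prod.distrib mult_ac)
  qed
  also have "\<dots> = det (mat n n (\<lambda>(i, j). \<Sum>k\<le>N. w i k * entry a b c (n - 1 - j) j (x i * q ^ k)))"
    using sum_det_rows[of n "\<lambda>_. {..N}" "\<lambda>i j k. w i k * entry a b c (n - 1 - j) j (x i * q ^ k)"] by simp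
  also have "mat n n (\<lambda>(i, j). \<Sum>k\<le>N. w i k * entry a b c (n - 1 - j) j (x i * q ^ k))
    = mat n n (\<lambda>(i, j). \<rho> i * \<sigma> j * entry (a * q ^ N) b c (n - 1 - j) j (x i))"
    by (rule cong_mat) (simp_all only: row prod.case)
  also have "det \<dots> = (\<Prod>i<n. \<rho> i) * (\<Prod>j<n. \<sigma> j) * det (mat n n (\<lambda>(i, j). entry (a * q ^ N) b c (n - 1 - j) j (x i)))"
    by (rule det_scale)
  also have "det (mat n n (\<lambda>(i, j). entry (a * q ^ N) b c (n - 1 - j) j (x i)))
    = det_const (a * q ^ N) b c n * (\<Prod>i<n. x i ^ i) * pair_factor (a * q ^ N) x n"
    using det_X[of "a * q ^ N" N "\<lambda>_. 0"] by simp
  finally have A1: "A * det_const a b c n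
    = (\<Prod>i<n. \<rho> i) * (\<Prod>j<n. \<sigma> j) * det_const (a * q ^ N) b c n * pair_factor (a * q ^ N) x n"
    using x by (simp add: K_def)
  define \<rho>' where "\<rho>' i = P (a * q * x i ^ 2) N
       / (P (a * x i * q / b) N * P (a * x i * q / c) N * P (a * x i * q / d) N * P (a * q / (b * c * d * x i * q ^ (n - 1))) N)" for i
  have "(\<Prod>i<n. \<rho> i) = (\<Prod>i<n. \<rho>' i) * P (a * q / (b * c * q ^ (n - 1))) N ^ n"
    by (simp add: \<rho>_def \<rho>'_def prod.distrib prod_dividef)
  moreover have "P (a * q / (b * c * q ^ (n - 1))) N ^ n * det_const (a * q ^ N) b c n
    = (\<Prod>i<n. P (a * q / (b * c * q ^ i)) N) * det_const a b c n"
    using det_const_shift[OF nz(2,3), of a "n - 1" N] n by simp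
  moreover have "(\<Prod>j<n. \<sigma> j) = (\<Prod>i<n. P (a * q / (b * d * q ^ i)) N) * (\<Prod>i<n. P (a * q / (c * d * q ^ i)) N)"
    using prod.nat_diff_reindex[of "\<lambda>i. P (a * q / (b * d * q ^ i)) N" n]
    by (simp add: \<sigma>_def prod.distrib)
  ultimately have "A * det_const a b c n = ((\<Prod>i<n. \<rho>' i) * (\<Prod>i<n. P (a * q / (b * c * q ^ i)) N)
      * (\<Prod>i<n. P (a * q / (b * d * q ^ i)) N) * (\<Prod>i<n. P (a * q / (c * d * q ^ i)) N) * pair_factor (a * q ^ N) x n) * det_const a b c n"
    unfolding A1 by (simp add: mult_ac)
  then have "A = (\<Prod>i<n. \<rho>' i) * (\<Prod>i<n. P (a * q / (b * c * q ^ i)) N)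
      * (\<Prod>i<n. P (a * q / (b * d * q ^ i)) N) * (\<Prod>i<n. P (a * q / (c * d * q ^ i)) N) * pair_factor (a * q ^ N) x n"
    using mult_right_cancel[OF K0] by blast
  then have "A = rhs_prod a b c d x n N * pair_factor (a * q ^ N) x n"
    unfolding \<rho>'_def rhs_prod_def by (simp add: prod.distrib prod_dividef mult_ac)
  moreover have "lhs_sum a b c d e x n N = A / pair_factor (a * q ^ N) x n"
    unfolding lhs_sum_def A_def w_def by (simp add: sum_divide_distrib)
  ultimately show ?thesis using F0 by simp
qed

end

section \<open>Removing the genericity assumptions\<close>

text \<open>Otherwise the difference, being continuous at z, has no zero on a ball about z. This
  ball would lie in B, but balls are uncountable.\<close>

lemma isCont_eq_if_eq_off_countable:
  fixes f g :: "complex \<Rightarrow> complex"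
  assumes "isCont f z" "isCont g z" "countable B" "\<And>t. t \<notin> B \<Longrightarrow> f t = g t"
  shows "f z = g z"
proof (rule ccontr)
  assume "f z \<noteq> g z"
  then have "isCont (\<lambda>t. f t - g t) z" "f z - g z \<noteq> 0"
    using assms(1,2) by (auto intro: continuous_intros)
  then obtain r where r: "r > 0" "\<And>t. dist z t < r \<Longrightarrow> f t - g t \<noteq> 0"
    using continuous_at_avoid[of z "\<lambda>t. f t - g t" 0] by blast
  then have "ball z r \<subseteq> B"
    using assms(4) by (force simp: ball_def)
  then show False
    using uncountable_ball[OF r(1), of z] assms(3) countable_subset by blast
qed

context elliptic_nome
begin

lemma isCont_E_comp: "isCont f t \<Longrightarrow> f t \<noteq> 0 \<Longrightarrow> isCont (\<lambda>t. E (f t)) t"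
  using isCont_o2[of t f "\<lambda>x. E x"] isCont_ellE[OF norm_p] by blast

lemma isCont_P: "isCont f t \<Longrightarrow> f t \<noteq> 0 \<Longrightarrow> isCont (\<lambda>t. P (f t) k) t"
  unfolding P_def using q_nz by (intro continuous_intros isCont_E_comp) auto

lemma isCont_ft_term:
  assumes "isCont a t" "isCont b t" "isCont c t" "isCont d t" "isCont e t"
    and "a t \<noteq> 0" "b t \<noteq> 0" "c t \<noteq> 0" "d t \<noteq> 0" "e t \<noteq> 0"
    and "E (a t) \<noteq> 0" "P q k \<noteq> 0" "P (a t * q / b t) k \<noteq> 0" "P (a t * q / c t) k \<noteq> 0"
      "P (a t * q / d t) k \<noteq> 0" "P (a t * q / e t) k \<noteq> 0" "P (a t * q ^ (N + 1)) k \<noteq> 0"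
  shows "isCont (\<lambda>t. ft_term (a t) (b t) (c t) (d t) (e t) N k) t"
  unfolding ft_term_def
  using assms q_nz by (intro continuous_intros isCont_P isCont_E_comp) auto

lemma isCont_pair_factor:
  assumes "isCont a t" "a t \<noteq> 0" "\<And>i. i < n \<Longrightarrow> X i \<noteq> 0"
  shows "isCont (\<lambda>t. pair_factor (a t) X n) t"
  unfolding pair_factor_def
  using assms by (intro continuous_intros isCont_E_comp) auto

lemma countable_not_nonvanishing:
  assumes "w \<noteq> 0" "m > 0"
  shows "countable {t. \<not> (t \<noteq> 0 \<longrightarrow> nonvanishing (w * t ^ m))}"
proof (rule countable_subset)
  show "{t. \<not> (t \<noteq> 0 \<longrightarrow> nonvanishing (w * t ^ m))}
      \<subseteq> (\<Union>j::int. {t. t \<noteq> 0 \<and> E (w * q powi j * t ^ m) = 0})"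
    by (auto simp: nonvanishing_def mult_ac)
  show "countable (\<Union>j::int. {t. t \<noteq> 0 \<and> E (w * q powi j * t ^ m) = 0})"
    by (rule countable_UN[OF countableI_type], rule countable_ellE_zeros)
       (use norm_p q_nz assms in auto)
qed

text \<open>The exponents \<open>2 \<cdot> 10 = 1 + 2 + 4 + 13\<close> respect the balancing condition and move every monomial
  whose theta function could vanish.\<close>
lemma countable_not_generic_params:
  assumes nz: "a \<noteq> 0" "b \<noteq> 0" "c \<noteq> 0" "d \<noteq> 0" and x: "\<And>i. i < n \<Longrightarrow> x i \<noteq> 0"
  shows "countable {t. \<not> (t \<noteq> 0 \<longrightarrow> generic_params (a * t ^ 10) (b * t) (c * t ^ 2) (d * t ^ 4) x n)}"
proof -
  define Z where "Z w m = {t. \<not> (t \<noteq> 0 \<longrightarrow> nonvanishing (w * t ^ m))}" for w m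
  define B where "B = Z (c / b) 1 \<union> Z (a / (b * c)) 7 \<union> (\<Union>i\<in>{..<n}. Z (c * x i) 2 \<union> Z (a * x i / b) 9
     \<union> Z (a * x i / c) 8 \<union> Z (a * x i / d) 6 \<union> Z (a / (b * c * d * x i)) 3 \<union> (\<Union>j\<in>{..<n}. Z (a * x i * x j) 10))"
  have "countable B"
    unfolding B_def Z_def
    by (intro countable_Un countable_UN countable_not_nonvanishing countable_finite) (use nz x in auto)
  have "generic_params (a * t ^ 10) (b * t) (c * t ^ 2) (d * t ^ 4) x n"
    if t: "t \<noteq> 0" and "t \<notin> B" for t
  proof -
    have args: "c * t ^ 2 / (b * t) = c / b * t ^ 1" "a * t ^ 10 / (b * t * (c * t ^ 2)) = a / (b * c) * t ^ 7"
      "c * t ^ 2 * y = c * y * t ^ 2" "a * t ^ 10 * y / (b * t) = a * y / b * t ^ 9"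
      "a * t ^ 10 * y / (c * t ^ 2) = a * y / c * t ^ 8" "a * t ^ 10 * y / (d * t ^ 4) = a * y / d * t ^ 6"
      "a * t ^ 10 / (b * t * (c * t ^ 2) * (d * t ^ 4) * y) = a / (b * c * d * y) * t ^ 3"
      "a * t ^ 10 * y * z = a * y * z * t ^ 10" for y z
      using t by (simp_all add: eval_nat_numeral)
    show ?thesis
      unfolding generic_params_def args using that by (auto simp: B_def Z_def)
  qed
  then have "{t. \<not> (t \<noteq> 0 \<longrightarrow> generic_params (a * t ^ 10) (b * t) (c * t ^ 2) (d * t ^ 4) x n)} \<subseteq> B"
    by blast
  then show ?thesis using \<open>countable B\<close> countable_subset by blast
qed

text \<open>The parameters move along a curve through the given point at t = 1, with x fixed. All
  but countably many t are generic, and both sides are continuous at t = 1 because the denominators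
  of the identity do not vanish there. The quotients x_i / x_j do not move, so their condition is
  inherited from the hypotheses.\<close>

lemma lhs_sum_eq_rhs_prod:
  assumes n: "n > 0"
    and nz: "a \<noteq> 0" "b \<noteq> 0" "c \<noteq> 0" "d \<noteq> 0" and x: "\<And>i. i < n \<Longrightarrow> x i \<noteq> 0"
    and bal: "e = a ^ 2 * q ^ (N + 1) / (b * c * d * q ^ (n - 1))"
    and den_pair: "\<And>i j. i < j \<Longrightarrow> j < n \<Longrightarrow> E (x i / x j) \<noteq> 0 \<and> E (a * q ^ N * x i * x j) \<noteq> 0"
    and den_a: "\<And>i. i < n \<Longrightarrow> E (a * x i ^ 2) \<noteq> 0"
    and den_k: "\<And>i k. i < n \<Longrightarrow> k \<le> N \<Longrightarrow> P q k \<noteq> 0 \<and> P (a * x i * q / b) k \<noteq> 0 \<and> P (a * x i * q / c) k \<noteq> 0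
        \<and> P (a * x i * q / d) k \<noteq> 0 \<and> P (a * x i * q / e) k \<noteq> 0 \<and> P (a * x i ^ 2 * q ^ (N + 1)) k \<noteq> 0"
    and den_rhs: "\<And>i. i < n \<Longrightarrow> P (a * q / (b * c * d * x i * q ^ (n - 1))) N \<noteq> 0"
  shows "lhs_sum a b c d e x n N = rhs_prod a b c d x n N"
proof -
  note q = q_nz
  have e0: "e \<noteq> 0" using nz q by (simp add: bal)
  define f where "f t = lhs_sum (a * t ^ 10) (b * t) (c * t ^ 2) (d * t ^ 4) (e * t ^ 13) x n N" for t
  define g where "g t = rhs_prod (a * t ^ 10) (b * t) (c * t ^ 2) (d * t ^ 4) x n N" for t
  define B where "B = insert 0 {t. \<not> (t \<noteq> 0 \<longrightarrow> generic_params (a * t ^ 10) (b * t) (c * t ^ 2) (d * t ^ 4) x n)}"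
  have "f 1 = g 1"
  proof (rule isCont_eq_if_eq_off_countable[where f = f and g = g and z = 1 and B = B])
    show "countable B"
      unfolding B_def using countable_not_generic_params[OF nz x] by simp
    show "f t = g t" if "t \<notin> B" for t
    proof -
      have t: "t \<noteq> 0" "generic_params (a * t ^ 10) (b * t) (c * t ^ 2) (d * t ^ 4) x n"
        using that by (auto simp: B_def)
      show ?thesis
        unfolding f_def g_def
      proof (rule lhs_sum_eq_rhs_prod_generic[OF t(2) n])
        have args: "b * t * (c * t ^ 2) * (d * t ^ 4) * q ^ (n - 1) = b * c * d * q ^ (n - 1) * t ^ 7"
          "(a * t ^ 10) ^ 2 * q ^ (N + 1) = a ^ 2 * q ^ (N + 1) * t ^ 13 * t ^ 7"
          by (simp_all add: eval_nat_numeral mult_ac)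
        show "e * t ^ 13 = (a * t ^ 10) ^ 2 * q ^ (N + 1) / (b * t * (c * t ^ 2) * (d * t ^ 4) * q ^ (n - 1))"
          unfolding args bal using t(1) by simp
        show "P q N \<noteq> 0" using den_k[of 0 N] n by simp
      qed (use nz x t den_pair in auto)
    qed
    have F0: "pair_factor (a * q ^ N) x n \<noteq> 0"
      using den_pair by (simp add: pair_factor_def)
    have ak: "a * x i ^ 2 * q / (y * x i) = a * x i * q / y" if "i < n" for i y
      using x[OF that] by (simp add: power2_eq_square)
    show "isCont f 1"
      unfolding f_def lhs_sum_def
    proof (intro continuous_intros isCont_pair_factor)
      fix k i
      assume k: "k \<in> {..<n} \<rightarrow>\<^sub>E {..N}" and "i \<in> {..<n}"
      then have i: "i < n" "k i \<le> N" by auto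
      show "isCont (\<lambda>t. ft_term (a * t ^ 10 * x i ^ 2) (b * t * x i) (c * t ^ 2 * x i) (d * t ^ 4 * x i) (e * t ^ 13 * x i) N (k i)) 1"
        by (intro isCont_ft_term continuous_intros)
           (use nz e0 x[OF i(1)] den_a[OF i(1)] den_k[OF i] ak[OF i(1)] in auto)
    qed (use nz q x F0 in auto)
    show "isCont g 1"
      unfolding g_def rhs_prod_def
      by (intro continuous_intros isCont_P) (use nz q x den_k den_rhs in auto)
  qed
  then show ?thesis by (simp add: f_def g_def)
qed

end

section \<open>Reindexing from 1, ..., n to 0, ..., n - 1\<close>

lemma prod_pairs_shift:
  fixes G :: "nat \<Rightarrow> nat \<Rightarrow> 'a :: comm_monoid_mult"
  shows "(\<Prod>i\<in>{1..n}. \<Prod>j\<in>{1..n}. if i < j then G i j else 1) = (\<Prod>j<n. \<Prod>i<j. G (Suc i) (Suc j))"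
proof -
  have "(\<Prod>i\<in>{1..n}. \<Prod>j\<in>{1..n}. if i < j then G i j else 1)
    = (\<Prod>j<n. \<Prod>i<n. if i < j then G (Suc i) (Suc j) else 1)"
    by (subst prod.swap) (simp add: prod.atLeast1_atMost_eq)
  also have "\<dots> = (\<Prod>j<n. \<Prod>i<j. G (Suc i) (Suc j))"
  proof (rule prod.cong[OF refl])
    fix j assume "j \<in> {..<n}"
    then show "(\<Prod>i<n. if i < j then G (Suc i) (Suc j) else 1) = (\<Prod>i<j. G (Suc i) (Suc j))"
      by (intro prod.mono_neutral_cong_right) auto
  qed
  finally show ?thesis .
qed

text \<open>Members of \<open>PiE\<close> are undefined outside their domain, so the shifted index
  functions are cut off by \<open>restrict\<close> to make the shift a bijection.\<close>

lemma sum_PiE_shift: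
  fixes h :: "(nat \<Rightarrow> 'b) \<Rightarrow> 'a :: comm_monoid_add"
  shows "(\<Sum>k\<in>PiE {1..n} (\<lambda>_. S). h (restrict (\<lambda>i. k (Suc i)) {..<n})) = (\<Sum>k\<in>PiE {..<n} (\<lambda>_. S). h k)"
proof (rule sum.reindex_bij_witness[where i = "\<lambda>k. restrict (\<lambda>i. k (i - 1)) {1..n}" and j = "\<lambda>k. restrict (\<lambda>i. k (Suc i)) {..<n}"])
  fix k assume k: "k \<in> PiE {1..n} (\<lambda>_. S)"
  show "restrict (\<lambda>i. restrict (\<lambda>i. k (Suc i)) {..<n} (i - 1)) {1..n} = k"
    by (rule extensionalityI[where A = "{1..n}"]) (use k in \<open>auto simp: PiE_def\<close>)
  show "restrict (\<lambda>i. k (Suc i)) {..<n} \<in> PiE {..<n} (\<lambda>_. S)" using k by auto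
next
  fix k assume k: "k \<in> PiE {..<n} (\<lambda>_. S)"
  show "restrict (\<lambda>i. restrict (\<lambda>i. k (i - 1)) {1..n} (Suc i)) {..<n} = k"
    by (rule extensionalityI[where A = "{..<n}"]) (use k in \<open>auto simp: PiE_def\<close>)
  show "restrict (\<lambda>i. k (i - 1)) {1..n} \<in> PiE {1..n} (\<lambda>_. S)" using k by (auto simp: PiE_iff)
qed simp

theorem theorem5p1:
  fixes p q a b c d e :: complex and x :: "nat \<Rightarrow> complex" and n N :: nat
  assumes hp: "norm p < 1"
    and hq: "q \<noteq> 0"
    and hnz: "a \<noteq> 0" "b \<noteq> 0" "c \<noteq> 0" "d \<noteq> 0" "e \<noteq> 0"
    and hx: "\<forall>i\<in>{1..n}. x i \<noteq> 0"
    and hbal: "a ^ 2 * q powi (int N - int n + 2) = b * c * d * e"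
    and hden_pair: "\<forall>i\<in>{1..n}. \<forall>j\<in>{1..n}. i < j \<longrightarrow>
        ellE (x i / x j) p \<noteq> 0 \<and> ellE (a * x i * x j * q ^ N) p \<noteq> 0"
    and hden_single: "\<forall>i\<in>{1..n}. ellE (a * x i ^ 2) p \<noteq> 0 \<and>
        (\<forall>k\<le>N. ellpoch q q p (int k) \<noteq> 0 \<and> ellpoch (a * q * x i / b) q p (int k) \<noteq> 0
           \<and> ellpoch (a * q * x i / c) q p (int k) \<noteq> 0 \<and> ellpoch (a * q * x i / d) q p (int k) \<noteq> 0
           \<and> ellpoch (a * q * x i / e) q p (int k) \<noteq> 0
           \<and> ellpoch (a * x i ^ 2 * q ^ (N + 1)) q p (int k) \<noteq> 0)"
    and hden_rhs: "\<forall>i\<in>{1..n}.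
        ellpoch (a * q powi (2 - int n) / (b * c * d * x i)) q p (int N) \<noteq> 0"
  shows "(\<Sum>k\<in>PiE {1..n} (\<lambda>_. {0..N}).
      (\<Prod>i\<in>{1..n}. \<Prod>j\<in>{1..n}. if i < j then
          (ellE (q powi (int (k i) - int (k j)) * x i / x j) p / ellE (x i / x j) p)
          * (ellE (a * x i * x j * q ^ (k i + k j)) p / ellE (a * x i * x j * q ^ N) p)
        else 1)
      * (\<Prod>i\<in>{1..n}.
          (ellE (a * x i ^ 2 * q ^ (2 * k i)) p / ellE (a * x i ^ 2) p)
          * (ellpoch (a * x i ^ 2) q p (int (k i)) * ellpoch (b * x i) q p (int (k i))
             * ellpoch (c * x i) q p (int (k i)) * ellpoch (d * x i) q p (int (k i))
             * ellpoch (e * x i) q p (int (k i)) * ellpoch (q powi (- int N)) q p (int (k i))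
             * q ^ (i * k i))
          / (ellpoch q q p (int (k i)) * ellpoch (a * q * x i / b) q p (int (k i))
             * ellpoch (a * q * x i / c) q p (int (k i)) * ellpoch (a * q * x i / d) q p (int (k i))
             * ellpoch (a * q * x i / e) q p (int (k i))
             * ellpoch (a * x i ^ 2 * q ^ (N + 1)) q p (int (k i)))))
    = (\<Prod>i\<in>{1..n}.
        (ellpoch (a * q * x i ^ 2) q p (int N)
         * ellpoch (a * q powi (2 - int i) / (b * c)) q p (int N)
         * ellpoch (a * q powi (2 - int i) / (b * d)) q p (int N)
         * ellpoch (a * q powi (2 - int i) / (c * d)) q p (int N))
        / (ellpoch (a * q powi (2 - int n) / (b * c * d * x i)) q p (int N)
           * ellpoch (a * q * x i / b) q p (int N)
           * ellpoch (a * q * x i / c) q p (int N)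
           * ellpoch (a * q * x i / d) q p (int N)))"
proof (cases "n = 0")
  case True
  then show ?thesis by simp
next
  case False
  interpret elliptic_nome p q using hp hq by unfold_locales
  define X where "X i = x (Suc i)" for i
  have X: "X i \<noteq> 0" if "i < n" for i using hx that by (simp add: X_def)
  have qm: "q powi (- int N) = 1 / q ^ N" by (simp add: power_int_minus divide_inverse)
  have qi: "q powi (2 - int (Suc i)) = q / q ^ i" for i
    using hq by (simp add: power_int_diff)
  have qn: "q powi (2 - int n) = q / q ^ (n - 1)" using qi[of "n - 1"] False by simp
  \<comment> \<open>For n > 0 the natural subtraction \<open>n - 1\<close> is exact, which turns the
    integer exponents into quotients of natural powers.\<close>
  have "int N - int n + 2 = int (N + 1) - int (n - 1)" using False by simp
  then have "q powi (int N - int n + 2) = q ^ (N + 1) / q ^ (n - 1)"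
    using power_int_diff[of q "int (N + 1)" "int (n - 1)"] hq by (simp only: power_int_of_nat) simp
  with hbal have "a ^ 2 * q ^ (N + 1) / q ^ (n - 1) = b * c * d * e" by simp
  then have bal: "e = a ^ 2 * q ^ (N + 1) / (b * c * d * q ^ (n - 1))"
    using hnz hq by (simp add: field_simps)
  have shift: "prod g {1..n} = (\<Prod>i<n. g (Suc i))" for g :: "nat \<Rightarrow> complex"
    by (simp add: prod.atLeast1_atMost_eq)
  have qd: "a * (q / q ^ m) / y = a * q / (y * q ^ m)" for m y by simp
  have "lhs_sum a b c d e X n N = rhs_prod a b c d X n N"
  proof (rule lhs_sum_eq_rhs_prod[OF _ hnz(1-4) X bal])
    show "n > 0" using False by simp
    show "E (X i / X j) \<noteq> 0 \<and> E (a * q ^ N * X i * X j) \<noteq> 0" if "i < j" "j < n" for i j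
    proof -
      have "a * q ^ N * X i * X j = a * x (Suc i) * x (Suc j) * q ^ N" by (simp add: X_def)
      moreover have "Suc i \<in> {1..n}" "Suc j \<in> {1..n}" "Suc i < Suc j" using that by auto
      ultimately show ?thesis using hden_pair by (simp only: X_def) blast
    qed
    fix i assume i: "i < n"
    then have i': "Suc i \<in> {1..n}" by simp
    show "E (a * X i ^ 2) \<noteq> 0" using hden_single i' by (simp add: X_def)
    show "P q k \<noteq> 0 \<and> P (a * X i * q / b) k \<noteq> 0 \<and> P (a * X i * q / c) k \<noteq> 0
        \<and> P (a * X i * q / d) k \<noteq> 0 \<and> P (a * X i * q / e) k \<noteq> 0 \<and> P (a * X i ^ 2 * q ^ (N + 1)) k \<noteq> 0"
      if "k \<le> N" for k
      using bspec[OF hden_single i'] that unfolding ellpoch_eq_P X_def by (simp add: mult_ac)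
    show "P (a * q / (b * c * d * X i * q ^ (n - 1))) N \<noteq> 0"
      using hden_rhs i' unfolding ellpoch_eq_P X_def qn qd by simp
  qed
  moreover have "rhs_prod a b c d X n N = (\<Prod>i\<in>{1..n}.
        (ellpoch (a * q * x i ^ 2) q p (int N)
         * ellpoch (a * q powi (2 - int i) / (b * c)) q p (int N)
         * ellpoch (a * q powi (2 - int i) / (b * d)) q p (int N)
         * ellpoch (a * q powi (2 - int i) / (c * d)) q p (int N))
        / (ellpoch (a * q powi (2 - int n) / (b * c * d * x i)) q p (int N)
           * ellpoch (a * q * x i / b) q p (int N)
           * ellpoch (a * q * x i / c) q p (int N)
           * ellpoch (a * q * x i / d) q p (int N)))"
    unfolding rhs_prod_def shift ellpoch_eq_P X_def[symmetric] qi qn qd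
    by (simp only: mult_ac)
  moreover have "(\<Sum>k\<in>PiE {1..n} (\<lambda>_. {0..N}).
      (\<Prod>i\<in>{1..n}. \<Prod>j\<in>{1..n}. if i < j then
          (ellE (q powi (int (k i) - int (k j)) * x i / x j) p / ellE (x i / x j) p)
          * (ellE (a * x i * x j * q ^ (k i + k j)) p / ellE (a * x i * x j * q ^ N) p)
        else 1)
      * (\<Prod>i\<in>{1..n}.
          (ellE (a * x i ^ 2 * q ^ (2 * k i)) p / ellE (a * x i ^ 2) p)
          * (ellpoch (a * x i ^ 2) q p (int (k i)) * ellpoch (b * x i) q p (int (k i))
             * ellpoch (c * x i) q p (int (k i)) * ellpoch (d * x i) q p (int (k i))
             * ellpoch (e * x i) q p (int (k i)) * ellpoch (q powi (- int N)) q p (int (k i))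
             * q ^ (i * k i))
          / (ellpoch q q p (int (k i)) * ellpoch (a * q * x i / b) q p (int (k i))
             * ellpoch (a * q * x i / c) q p (int (k i)) * ellpoch (a * q * x i / d) q p (int (k i))
             * ellpoch (a * q * x i / e) q p (int (k i))
             * ellpoch (a * x i ^ 2 * q ^ (N + 1)) q p (int (k i)))))
    = lhs_sum a b c d e X n N"
    unfolding lhs_sum_def atLeast0AtMost sum_PiE_shift[symmetric]
  proof (rule sum.cong[OF refl], rule arg_cong2[where f = "(*)"])
    fix k :: "nat \<Rightarrow> nat"
    let ?k = "restrict (\<lambda>i. k (Suc i)) {..<n}"
    show "(\<Prod>i\<in>{1..n}. \<Prod>j\<in>{1..n}. if i < j then
          (ellE (q powi (int (k i) - int (k j)) * x i / x j) p / ellE (x i / x j) p)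
          * (ellE (a * x i * x j * q ^ (k i + k j)) p / ellE (a * x i * x j * q ^ N) p)
        else 1) = pair_factor a (\<lambda>i. X i * q ^ ?k i) n / pair_factor (a * q ^ N) X n"
      unfolding prod_pairs_shift pair_factor_def prod_dividef[symmetric]
    proof (intro prod.cong refl)
      fix j i assume "j \<in> {..<n}" "i \<in> {..<j}"
      then have ij: "?k i = k (Suc i)" "?k j = k (Suc j)" by auto
      have "q powi (int (k (Suc i)) - int (k (Suc j))) * x (Suc i) / x (Suc j)
          = X i * q ^ k (Suc i) / (X j * q ^ k (Suc j))"
        using hq by (simp add: power_int_diff X_def mult.commute)
      moreover have "a * x (Suc i) * x (Suc j) * q ^ (k (Suc i) + k (Suc j))
          = a * (X i * q ^ k (Suc i)) * (X j * q ^ k (Suc j))"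
        by (simp add: X_def power_add)
      moreover have "a * x (Suc i) * x (Suc j) * q ^ N = a * q ^ N * X i * X j"
        by (simp add: X_def)
      ultimately show "(ellE (q powi (int (k (Suc i)) - int (k (Suc j))) * x (Suc i) / x (Suc j)) p / ellE (x (Suc i) / x (Suc j)) p)
          * (ellE (a * x (Suc i) * x (Suc j) * q ^ (k (Suc i) + k (Suc j))) p / ellE (a * x (Suc i) * x (Suc j) * q ^ N) p)
        = E (X i * q ^ ?k i / (X j * q ^ ?k j)) * E (a * (X i * q ^ ?k i) * (X j * q ^ ?k j))
          / (E (X i / X j) * E (a * q ^ N * X i * X j))"
        unfolding ij by (simp only: X_def times_divide_times_eq)
    qed
    show "(\<Prod>i\<in>{1..n}.
          (ellE (a * x i ^ 2 * q ^ (2 * k i)) p / ellE (a * x i ^ 2) p)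
          * (ellpoch (a * x i ^ 2) q p (int (k i)) * ellpoch (b * x i) q p (int (k i))
             * ellpoch (c * x i) q p (int (k i)) * ellpoch (d * x i) q p (int (k i))
             * ellpoch (e * x i) q p (int (k i)) * ellpoch (q powi (- int N)) q p (int (k i))
             * q ^ (i * k i))
          / (ellpoch q q p (int (k i)) * ellpoch (a * q * x i / b) q p (int (k i))
             * ellpoch (a * q * x i / c) q p (int (k i)) * ellpoch (a * q * x i / d) q p (int (k i))
             * ellpoch (a * q * x i / e) q p (int (k i))
             * ellpoch (a * x i ^ 2 * q ^ (N + 1)) q p (int (k i))))
      = (\<Prod>i<n. ft_term (a * X i ^ 2) (b * X i) (c * X i) (d * X i) (e * X i) N (?k i) * q ^ (i * ?k i))"
      unfolding shift
    proof (rule prod.cong[OF refl])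
      fix i assume "i \<in> {..<n}"
      then have k: "?k i = k (Suc i)" and Xi: "X i \<noteq> 0" using X by auto
      \<comment> \<open>The series in k_i has base \<open>a * X i ^ 2\<close> and parameters
        \<open>b * X i\<close> and so on; one \<open>X i\<close> cancels in base times q over
        parameter.\<close>
      have "a * q * X i / y = a * X i ^ 2 * q / (y * X i)" for y
        using Xi by (simp add: power2_eq_square)
      then show "(ellE (a * x (Suc i) ^ 2 * q ^ (2 * k (Suc i))) p / ellE (a * x (Suc i) ^ 2) p)
          * (ellpoch (a * x (Suc i) ^ 2) q p (int (k (Suc i))) * ellpoch (b * x (Suc i)) q p (int (k (Suc i)))
             * ellpoch (c * x (Suc i)) q p (int (k (Suc i))) * ellpoch (d * x (Suc i)) q p (int (k (Suc i)))
             * ellpoch (e * x (Suc i)) q p (int (k (Suc i))) * ellpoch (q powi (- int N)) q p (int (k (Suc i)))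
             * q ^ (Suc i * k (Suc i)))
          / (ellpoch q q p (int (k (Suc i))) * ellpoch (a * q * x (Suc i) / b) q p (int (k (Suc i)))
             * ellpoch (a * q * x (Suc i) / c) q p (int (k (Suc i))) * ellpoch (a * q * x (Suc i) / d) q p (int (k (Suc i)))
             * ellpoch (a * q * x (Suc i) / e) q p (int (k (Suc i)))
             * ellpoch (a * x (Suc i) ^ 2 * q ^ (N + 1)) q p (int (k (Suc i))))
        = ft_term (a * X i ^ 2) (b * X i) (c * X i) (d * X i) (e * X i) N (?k i) * q ^ (i * ?k i)"
        unfolding k ft_term_def ellpoch_eq_P X_def[symmetric] qm mult_Suc power_add
        by (simp only: mult_ac times_divide_eq_left times_divide_eq_right)
    qed
  qed
  ultimately show ?thesis by simp
qed

end
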